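(* Let $d\ge1$ and let $\Sigma$ be a $d$-dimensional simplicial sphere (a simplicial complex homeomorphic to the $d$-sphere) with $n$ facets. Then $K_{d-1}(\Sigma)\cong\mathbb{Z}/n\mathbb{Z}$.
   Context: For a finite simplicial complex $\Delta$, $C_i(\Delta;\mathbb{Z})$ is the free abelian group on the $i$-dimensional faces (each with a fixed orientation), $\partial_i:C_i\to C_{i-1}$ is the simplicial boundary map, and $\partial^*_i$ is its transpose with respect to the standard bases. The $i$-dimensional critical group is $K_i(\Delta)=\ker\partial_i/\operatorname{im}(\partial_{i+1}\partial^*_{i+1})$. Facets are the $d$-dimensional faces. *)

theory Defs
  imports "HOL-Analysis.Analysis" "HOL-Algebra.Elementary_Groups" "HOL-Algebra.Coset"
begin

(* A finite abstract simplicial complex on a finite, linearly ordered vertex type.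
   Faces are vertex sets; the empty face (dimension -1) belongs to every nonempty complex. *)
definition simplicial_complex :: "('v::finite) set set \<Rightarrow> bool" where
  "simplicial_complex \<Delta> \<longleftrightarrow> (\<forall>\<sigma>\<in>\<Delta>. \<forall>\<tau>. \<tau> \<subseteq> \<sigma> \<longrightarrow> \<tau> \<in> \<Delta>)"

definition geom_realization :: "('v::finite) set set \<Rightarrow> (real^'v) set" where
  "geom_realization \<Delta> = (\<Union>\<sigma>\<in>\<Delta>. convex hull ((\<lambda>v. axis v 1) ` \<sigma>))"

definition faces :: "'v set set \<Rightarrow> nat \<Rightarrow> 'v set set" where
  "faces \<Delta> i = {\<sigma>\<in>\<Delta>. card \<sigma> = i + 1}"

(* faces with exactly i vertices, i.e. (i-1)-dimensional faces (i = 0: the empty face) *)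
definition lower_faces :: "'v set set \<Rightarrow> nat \<Rightarrow> 'v set set" where
  "lower_faces \<Delta> i = {\<tau>\<in>\<Delta>. card \<tau> = i}"

(* Orientation induced by the linear order of vertices:
   boundary of [v_0 < ... < v_k] is sum_j (-1)^j [v_0..^v_j..v_k]. *)
definition bdry_coeff :: "('v::linorder) set \<Rightarrow> 'v set \<Rightarrow> int" where
  "bdry_coeff \<sigma> \<tau> =
     (if \<tau> \<subseteq> \<sigma> \<and> card \<sigma> = Suc (card \<tau>)
      then (-1) ^ card {w\<in>\<sigma>. w < the_elem (\<sigma> - \<tau>)} else 0)"

definition chains :: "'v set set \<Rightarrow> nat \<Rightarrow> ('v set \<Rightarrow> int) set" where
  "chains \<Delta> i = {c. \<forall>\<sigma>. \<sigma> \<notin> faces \<Delta> i \<longrightarrow> c \<sigma> = 0}"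

definition chain_group :: "'v set set \<Rightarrow> nat \<Rightarrow> ('v set \<Rightarrow> int) monoid" where
  "chain_group \<Delta> i = \<lparr>carrier = chains \<Delta> i, monoid.mult = (\<lambda>x y \<sigma>. x \<sigma> + y \<sigma>), one = (\<lambda>_. 0)\<rparr>"

definition boundary :: "('v::linorder) set set \<Rightarrow> nat \<Rightarrow> ('v set \<Rightarrow> int) \<Rightarrow> ('v set \<Rightarrow> int)" where
  "boundary \<Delta> i c = (\<lambda>\<tau>. if \<tau> \<in> lower_faces \<Delta> i
                          then (\<Sum>\<sigma>\<in>faces \<Delta> i. bdry_coeff \<sigma> \<tau> * c \<sigma>) else 0)"

definition coboundary :: "('v::linorder) set set \<Rightarrow> nat \<Rightarrow> ('v set \<Rightarrow> int) \<Rightarrow> ('v set \<Rightarrow> int)" where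
  "coboundary \<Delta> i c = (\<lambda>\<sigma>. if \<sigma> \<in> faces \<Delta> i
                          then (\<Sum>\<tau>\<in>lower_faces \<Delta> i. bdry_coeff \<sigma> \<tau> * c \<tau>) else 0)"

definition cycles :: "('v::linorder) set set \<Rightarrow> nat \<Rightarrow> ('v set \<Rightarrow> int) set" where
  "cycles \<Delta> i = {c \<in> chains \<Delta> i. boundary \<Delta> i c = (\<lambda>_. 0)}"

definition laplacian_image :: "('v::linorder) set set \<Rightarrow> nat \<Rightarrow> ('v set \<Rightarrow> int) set" where
  "laplacian_image \<Delta> i = (\<lambda>c. boundary \<Delta> (i+1) (coboundary \<Delta> (i+1) c)) ` chains \<Delta> i"

definition critical_group :: "('v::linorder) set set \<Rightarrow> nat \<Rightarrow> ('v set \<Rightarrow> int) set monoid" where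
  "critical_group \<Delta> i = ((chain_group \<Delta> i)\<lparr>carrier := cycles \<Delta> i\<rparr>) Mod laplacian_image \<Delta> i"

end

theory Submission
  imports Defs "HOL-Library.Poly_Mapping"
begin

text \<open>
  Removing a facet \<open>\<sigma>\<close> from the sphere leaves a complex whose realization is a retract of a punctured
  sphere, hence contractible. A complex \<open>L\<close> with contractible realization has an acyclic augmented
  chain complex: replace simplices by tuples of nearby points. Acyclic carriers give chain maps from
  simplicial chains to fine tuple chains and back (sending a point to a vertex with large barycentric
  coordinate) whose composite is homotopic to the identity, while a contraction of \<open>|L|\<close>, sampled at
  finitely many times, makes every fine tuple cycle bound.

  Consequently \<open>L\<close> has a contracting chain homotopy. Applied to all facets this yields a cycle \<open>z\<close>
  with coefficients \<open>\<plusminus>1\<close> generating \<open>ker \<partial>\<^sub>d\<close>, the equality \<open>im \<partial>\<^sub>d = ker \<partial>\<^sub>d\<^sub>-\<^sub>1\<close>, and that the image of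
  \<open>\<partial>\<^sub>d\<^sup>*\<close> is the orthogonal complement of \<open>z\<close>. Therefore \<open>\<partial>e \<mapsto> \<langle>z, e\<rangle>\<close> identifies the critical group
  with the integers modulo \<open>\<langle>z, z\<rangle> = n\<close>.
\<close>

subsection \<open>Acyclic carriers\<close>

lemma frag_extend_frag_extend:
  "frag_extend f (frag_extend g c) = frag_extend (\<lambda>x. frag_extend f (g x)) c"
  using subset_UNIV
  by (induction c rule: frag_induction) (auto simp: frag_extend_diff)

lemma frag_extend_add_fun: "frag_extend (\<lambda>x. f x + g x) c = frag_extend f c + frag_extend g c"
  using subset_UNIV
  by (induction c rule: frag_induction) (auto simp: frag_extend_diff)

lemma frag_extend_diff_fun: "frag_extend (\<lambda>x. f x - g x) c = frag_extend f c - frag_extend g c"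
  using subset_UNIV
  by (induction c rule: frag_induction) (auto simp: frag_extend_diff)

lemma frag_extend_cmul_fun: "frag_extend (\<lambda>x. frag_cmul k (f x)) c = frag_cmul k (frag_extend f c)"
  using subset_UNIV
  by (induction c rule: frag_induction)
    (auto simp: frag_extend_diff poly_mapping_eqI lookup_minus right_diff_distrib)

lemma keys_frag_extend_subset:
  assumes "\<And>x. x \<in> Poly_Mapping.keys c \<Longrightarrow> Poly_Mapping.keys (f x) \<subseteq> S"
  shows "Poly_Mapping.keys (frag_extend f c) \<subseteq> S"
  using keys_frag_extend[of f c] assms by blast

text \<open>
  The rank is the dimension plus one: the empty tuple or face has rank 0, so all complexes are augmented.
\<close>
definition acyclic_on :: "('b \<Rightarrow> 'b \<Rightarrow>\<^sub>0 int) \<Rightarrow> ('b \<Rightarrow> nat) \<Rightarrow> 'b set \<Rightarrow> bool" where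
  "acyclic_on bd rk K \<longleftrightarrow>
     (\<forall>p c. Poly_Mapping.keys c \<subseteq> {b\<in>K. rk b = p} \<longrightarrow> frag_extend bd c = 0 \<longrightarrow>
        (\<exists>e. Poly_Mapping.keys e \<subseteq> {b\<in>K. rk b = Suc p} \<and> frag_extend bd e = c))"

lemma acyclic_onD:
  assumes "acyclic_on bd rk K" "Poly_Mapping.keys c \<subseteq> {b\<in>K. rk b = p}" "frag_extend bd c = 0"
  obtains e where "Poly_Mapping.keys e \<subseteq> {b\<in>K. rk b = Suc p}" "frag_extend bd e = c"
  using assms unfolding acyclic_on_def by blast

text \<open>
  The method of acyclic carriers in a form that covers both the construction of a chain map
  (\<^term>\<open>u = (\<lambda>_. 0)\<close>, \<^term>\<open>s = 1\<close>, \<^term>\<open>q = 0\<close>) and that of a chain homotopy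
  (\<^term>\<open>u\<close> the difference of two chain maps, \<^term>\<open>s = -1\<close>, \<^term>\<open>q = 1\<close>).
\<close>
lemma acyclic_carrier:
  fixes bdA :: "'a \<Rightarrow> 'a \<Rightarrow>\<^sub>0 int" and rkA :: "'a \<Rightarrow> nat"
    and bdB :: "'b \<Rightarrow> 'b \<Rightarrow>\<^sub>0 int" and rkB :: "'b \<Rightarrow> nat"
    and u h0 :: "'a \<Rightarrow> 'b \<Rightarrow>\<^sub>0 int" and s :: int
  assumes keysA: "\<And>a. a \<in> S \<Longrightarrow> Poly_Mapping.keys (bdA a) \<subseteq> {b\<in>S. Suc (rkA b) = rkA a}"
    and bdbdA: "\<And>a. a \<in> S \<Longrightarrow> frag_extend bdA (bdA a) = 0"
    and K_mono: "\<And>a b. a \<in> S \<Longrightarrow> b \<in> Poly_Mapping.keys (bdA a) \<Longrightarrow> K b \<subseteq> K a"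
    and acyclic: "\<And>a. a \<in> S \<Longrightarrow> rkA a > 0 \<Longrightarrow> acyclic_on bdB rkB (K a)"
    and base: "\<And>a. a \<in> S \<Longrightarrow> rkA a = 0 \<Longrightarrow> Poly_Mapping.keys (h0 a) \<subseteq> {b\<in>K a. rkB b = q}"
      "\<And>a. a \<in> S \<Longrightarrow> rkA a = 0 \<Longrightarrow> frag_extend bdB (h0 a) = u a"
    and keys_u: "\<And>a. a \<in> S \<Longrightarrow> Poly_Mapping.keys (u a) \<subseteq> {b\<in>K a. Suc (rkB b) = rkA a + q}"
    and bd_u: "\<And>a. a \<in> S \<Longrightarrow> frag_extend bdB (u a) = frag_cmul (- s) (frag_extend u (bdA a))"
    and s: "s * s = 1"
  obtains h where
    "\<And>a. a \<in> S \<Longrightarrow> Poly_Mapping.keys (h a) \<subseteq> {b\<in>K a. rkB b = rkA a + q}"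
    "\<And>a. a \<in> S \<Longrightarrow> frag_extend bdB (h a) = u a + frag_cmul s (frag_extend h (bdA a))"
    "\<And>a. a \<in> S \<Longrightarrow> rkA a = 0 \<Longrightarrow> h a = h0 a"
proof -
  \<comment> \<open>Recursion on the rank: each layer picks fillings for the chains built from the
    layer below, and \<open>h\<close> evaluates an element in the layer of its own rank.\<close>
  define F where "F = rec_nat h0 (\<lambda>n f a. SOME e. Poly_Mapping.keys e \<subseteq> {b\<in>K a. rkB b = rkA a + q} \<and>
     frag_extend bdB e = u a + frag_cmul s (frag_extend f (bdA a)))"
  define h where "h a = F (rkA a) a" for a
  have h_F: "frag_extend h (bdA a) = frag_extend (F n) (bdA a)" if "a \<in> S" "rkA a = Suc n" for a n
    using keysA[OF that(1)] that(2) by (intro frag_extend_eq) (auto simp: h_def)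
  have "\<forall>a\<in>S. rkA a = n \<longrightarrow> Poly_Mapping.keys (h a) \<subseteq> {b\<in>K a. rkB b = rkA a + q} \<and>
     frag_extend bdB (h a) = u a + frag_cmul s (frag_extend h (bdA a))" for n
  proof (induction n)
    case 0
    \<comment> \<open>A key of this boundary would have rank -1, so the recursive term vanishes and
      \<open>base\<close> is the whole claim.\<close>
    have "bdA a = 0" if "a \<in> S" "rkA a = 0" for a
      using keysA[OF that(1)] that(2) by (auto simp flip: keys_eq_empty)
    with base show ?case by (auto simp: h_def F_def)
  next
    case (Suc n)
    show ?case
    proof (intro ballI impI)
      fix a assume a: "a \<in> S" "rkA a = Suc n"
      let ?t = "u a + frag_cmul s (frag_extend h (bdA a))"
      have k: "Poly_Mapping.keys (h b) \<subseteq> {x\<in>K a. rkB x = n + q}" 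
          and e: "frag_extend bdB (h b) = u b + frag_cmul s (frag_extend h (bdA b))"
          if "b \<in> Poly_Mapping.keys (bdA a)" for b
        using Suc keysA[OF a(1)] K_mono[OF a(1)] that a(2) by fastforce+
      have keys_t: "Poly_Mapping.keys ?t \<subseteq> {b\<in>K a. rkB b = n + q}"
      proof -
        have "Poly_Mapping.keys (frag_extend h (bdA a)) \<subseteq> {b\<in>K a. rkB b = n + q}"
          by (rule keys_frag_extend_subset) (use k in blast)
        moreover have "Poly_Mapping.keys (u a) \<subseteq> {b\<in>K a. rkB b = n + q}"
          using keys_u[OF a(1)] a(2) by auto
        ultimately show ?thesis
          using keys_add[of "u a"] keys_cmul by blast
      qed
      \<comment> \<open>The equation one rank lower together with \<open>bdbdA\<close> leaves only
        the \<open>u\<close> term. By \<open>bd_u\<close> it cancels in \<open>?t\<close>, so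
        \<open>?t\<close> is a cycle and can be filled inside \<open>K a\<close>.\<close>
      have "frag_extend bdB (frag_extend h (bdA a)) = 
          frag_extend (\<lambda>b. u b + frag_cmul s (frag_extend h (bdA b))) (bdA a)"
        unfolding frag_extend_frag_extend by (rule frag_extend_eq) (rule e)
      also have "\<dots> = frag_extend u (bdA a) + frag_cmul s (frag_extend h (frag_extend bdA (bdA a)))"
        by (simp add: frag_extend_add_fun frag_extend_cmul_fun frag_extend_frag_extend)
      finally have "frag_extend bdB (frag_extend h (bdA a)) = frag_extend u (bdA a)"
        using bdbdA[OF a(1)] by simp
      then have "frag_extend bdB ?t = 0"
        using bd_u[OF a(1)] by (simp add: frag_extend_add frag_extend_cmul flip: frag_cmul_distrib)
      then obtain e where "Poly_Mapping.keys e \<subseteq> {b\<in>K a. rkB b = rkA a + q}" "frag_extend bdB e = ?t"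
        using acyclic_onD[OF acyclic[OF a(1)] keys_t] a(2) by auto
      then have "\<exists>e. Poly_Mapping.keys e \<subseteq> {b\<in>K a. rkB b = rkA a + q} \<and> frag_extend bdB e = ?t"
        by blast
      then have "Poly_Mapping.keys (F (Suc n) a) \<subseteq> {b\<in>K a. rkB b = rkA a + q} \<and> frag_extend bdB (F (Suc n) a) = ?t"
        unfolding h_F[OF a] by (simp only: F_def old.nat.simps) (rule someI_ex)
      then show "Poly_Mapping.keys (h a) \<subseteq> {b\<in>K a. rkB b = rkA a + q} \<and> frag_extend bdB (h a) = ?t"
        using a(2) by (simp add: h_def)
    qed
  qed
  moreover have "h a = h0 a" if "rkA a = 0" for a using that by (simp add: h_def F_def)
  ultimately show ?thesis using that by blast
qed

subsection \<open>Chains of small tuples\<close>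

text \<open>The alternating sum of deletions. Tuples with repeated entries are kept as generators,
  and \<open>[x]\<close> has boundary \<open>[]\<close>, which builds in the augmentation.\<close>

primrec list_bd :: "'a list \<Rightarrow> 'a list \<Rightarrow>\<^sub>0 int" where
  "list_bd [] = 0"
| "list_bd (x # xs) = frag_of xs - frag_extend (\<lambda>l. frag_of (x # l)) (list_bd xs)"

abbreviation list_cone :: "'a \<Rightarrow> ('a list \<Rightarrow>\<^sub>0 int) \<Rightarrow> 'a list \<Rightarrow>\<^sub>0 int" where
  "list_cone x \<equiv> frag_extend (\<lambda>l. frag_of (x # l))"

abbreviation list_chain_map :: "('a \<Rightarrow> 'b) \<Rightarrow> ('a list \<Rightarrow>\<^sub>0 int) \<Rightarrow> 'b list \<Rightarrow>\<^sub>0 int" where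
  "list_chain_map f \<equiv> frag_extend (\<lambda>l. frag_of (map f l))"

lemma list_bd_list_cone: "frag_extend list_bd (list_cone x c) = c - list_cone x (frag_extend list_bd c)"
  by (simp add: frag_extend_frag_extend frag_extend_diff_fun flip: frag_expansion)

lemma list_bd_list_bd: "frag_extend list_bd (list_bd l) = 0"
  by (induction l) (simp_all add: frag_extend_diff list_bd_list_cone)

lemma keys_list_bd: "Poly_Mapping.keys (list_bd l) \<subseteq> {k. set k \<subseteq> set l \<and> Suc (length k) = length l}"
proof (induction l)
  case (Cons x xs)
  have "Poly_Mapping.keys (list_cone x (list_bd xs)) \<subseteq> {k. set k \<subseteq> set (x # xs) \<and> Suc (length k) = length (x # xs)}"
    by (rule keys_frag_extend_subset) (use Cons in auto)
  then show ?case
    using keys_diff[of "frag_of xs" "list_cone x (list_bd xs)"] by fastforce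
qed simp

lemma list_bd_map: "list_bd (map f l) = list_chain_map f (list_bd l)"
  by (induction l) (simp_all add: frag_extend_diff frag_extend_frag_extend)

lemma list_bd_list_chain_map: "frag_extend list_bd (list_chain_map f c) = list_chain_map f (frag_extend list_bd c)"
  by (simp add: frag_extend_frag_extend list_bd_map)

text \<open>Prefixing a fixed point of \<open>X\<close> is a contracting homotopy; since repetitions
  are allowed, every tuple can be coned.\<close>

lemma acyclic_on_lists:
  assumes "x \<in> X"
  shows "acyclic_on list_bd length (lists X)"
  unfolding acyclic_on_def
proof (intro allI impI)
  fix p and c :: "'a list \<Rightarrow>\<^sub>0 int"
  assume c: "Poly_Mapping.keys c \<subseteq> {b \<in> lists X. length b = p}" "frag_extend list_bd c = 0"
  have "Poly_Mapping.keys (list_cone x c) \<subseteq> {b \<in> lists X. length b = Suc p}"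
    by (rule keys_frag_extend_subset) (use c assms in auto)
  moreover have "frag_extend list_bd (list_cone x c) = c"
    using c by (simp add: list_bd_list_cone)
  ultimately show "\<exists>e. Poly_Mapping.keys e \<subseteq> {b \<in> lists X. length b = Suc p} \<and> frag_extend list_bd e = c"
    by blast
qed

text \<open>The ordered Vietoris-Rips complex of \<open>X\<close> at scale \<open>\<delta>\<close>;
  it always contains the empty tuple.\<close>

definition small_lists :: "real \<Rightarrow> 'a::metric_space set \<Rightarrow> 'a list set" where
  "small_lists \<delta> X = {l. set l \<subseteq> X \<and> (\<forall>x\<in>set l. \<forall>y\<in>set l. dist x y < \<delta>)}"

text \<open>Two vertex maps that stay close to each other play the role of contiguous maps.\<close>
lemma discrete_homotopy_step:
  fixes f g :: "'a \<Rightarrow> 'b::metric_space"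
  assumes len: "\<And>l. l \<in> Poly_Mapping.keys c \<Longrightarrow> length l = p"
    and cycle: "frag_extend list_bd c = 0"
    and X: "\<And>l. l \<in> Poly_Mapping.keys c \<Longrightarrow> f ` set l \<union> g ` set l \<subseteq> X"
    and close: "\<And>l x y. l \<in> Poly_Mapping.keys c \<Longrightarrow> x \<in> f ` set l \<union> g ` set l \<Longrightarrow>
        y \<in> f ` set l \<union> g ` set l \<Longrightarrow> dist x y < \<delta>"
  obtains b where "Poly_Mapping.keys b \<subseteq> {l \<in> small_lists \<delta> X. length l = Suc p}"
    "frag_extend list_bd b = list_chain_map g c - list_chain_map f c"
proof -
  \<comment> \<open>The carrier of a tuple allows mixing of both images, hence closeness is required
    across \<open>f\<close> and \<open>g\<close> and not only within each of them.\<close>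
  let ?K = "\<lambda>l. lists (f ` set l \<union> g ` set l)"
  let ?u = "\<lambda>l. frag_of (map g l) - frag_of (map f l)"
  obtain h :: "'a list \<Rightarrow> 'b list \<Rightarrow>\<^sub>0 int" where h:
    "\<And>a. a \<in> UNIV \<Longrightarrow> Poly_Mapping.keys (h a) \<subseteq> {b \<in> ?K a. length b = length a + 1}"
    "\<And>a. a \<in> UNIV \<Longrightarrow> frag_extend list_bd (h a) = ?u a + frag_cmul (- 1) (frag_extend h (list_bd a))"
  proof (rule acyclic_carrier[of UNIV list_bd length ?K list_bd length "\<lambda>_. 0" 1 ?u "- 1"])
    show "Poly_Mapping.keys (list_bd a) \<subseteq> {b \<in> UNIV. Suc (length b) = length a}" for a :: "'a list"
      using keys_list_bd by blast
    show "?K b \<subseteq> ?K a" if "b \<in> Poly_Mapping.keys (list_bd a)" for a b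
      using keys_list_bd[of a] that by (intro lists_mono) blast
    show "acyclic_on list_bd length (?K a)" if "0 < length a" for a
      using that by (intro acyclic_on_lists[of "f (hd a)"]) auto
    show "Poly_Mapping.keys (?u a) \<subseteq> {b \<in> ?K a. Suc (length b) = length a + 1}" for a
      using keys_diff[of "frag_of (map g a)" "frag_of (map f a)"] by fastforce
    show "frag_extend list_bd (?u a) = frag_cmul (- (- 1)) (frag_extend ?u (list_bd a))" for a
      by (simp add: frag_extend_diff list_bd_map frag_extend_diff_fun)
  qed (auto simp: list_bd_list_bd)
  show thesis
  proof
    show "Poly_Mapping.keys (frag_extend h c) \<subseteq> {l \<in> small_lists \<delta> X. length l = Suc p}"
    proof (rule keys_frag_extend_subset)
      fix l assume l: "l \<in> Poly_Mapping.keys c"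
      have "?K l \<subseteq> small_lists \<delta> X"
        using X[OF l] close[OF l] unfolding small_lists_def by (auto simp: in_lists_conv_set) blast+
      then show "Poly_Mapping.keys (h l) \<subseteq> {l \<in> small_lists \<delta> X. length l = Suc p}"
        using h(1)[of l] len[OF l] by auto
    qed
    show "frag_extend list_bd (frag_extend h c) = list_chain_map g c - list_chain_map f c"
      using h(2) cycle 
      by (simp add: frag_extend_frag_extend[of list_bd h] frag_extend_diff_fun flip: frag_extend_frag_extend)
  qed
qed

text \<open>Consecutive time samples are close maps, so their homotopies add up to a chain
  \<open>b\<close> joining \<open>c\<close> to its image under the last sample. That image consists
  of constant tuples at \<open>x0\<close>, where coning gives a filling \<open>e\<close>; then
  \<open>e - b\<close> fills \<open>c\<close>.\<close>

lemma discrete_contraction: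
  fixes F :: "nat \<Rightarrow> 'a \<Rightarrow> 'a::metric_space"
  assumes keys: "Poly_Mapping.keys c \<subseteq> {l. set l \<subseteq> Y \<and> length l = p}"
    and cycle: "frag_extend list_bd c = 0"
    and F: "\<And>x. x \<in> Y \<Longrightarrow> F 0 x = x" "\<And>x. x \<in> Y \<Longrightarrow> F m x = x0" "\<And>t x. x \<in> Y \<Longrightarrow> t \<le> m \<Longrightarrow> F t x \<in> X"
    and x0: "x0 \<in> X" "\<delta> > 0"
    and close: "\<And>l x y t t'. l \<in> Poly_Mapping.keys c \<Longrightarrow> x \<in> set l \<Longrightarrow> y \<in> set l \<Longrightarrow>
        t \<le> m \<Longrightarrow> t' \<le> m \<Longrightarrow> t \<le> Suc t' \<Longrightarrow> t' \<le> Suc t \<Longrightarrow> dist (F t x) (F t' y) < \<delta>"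
  obtains b where "Poly_Mapping.keys b \<subseteq> {l \<in> small_lists \<delta> X. length l = Suc p}" "frag_extend list_bd b = c"
proof -
  have "\<exists>b. Poly_Mapping.keys b \<subseteq> {l \<in> small_lists \<delta> X. length l = Suc p} \<and>
      frag_extend list_bd b = list_chain_map (F t) c - list_chain_map (F 0) c" if "t \<le> m" for t
    using that
  proof (induction t)
    case 0
    then show ?case by (intro exI[of _ 0]) simp
  next
    case (Suc t)
    then obtain b where b: "Poly_Mapping.keys b \<subseteq> {l \<in> small_lists \<delta> X. length l = Suc p}"
        "frag_extend list_bd b = list_chain_map (F t) c - list_chain_map (F 0) c" by auto
    obtain b' where b': "Poly_Mapping.keys b' \<subseteq> {l \<in> small_lists \<delta> X. length l = Suc p}"
        "frag_extend list_bd b' = list_chain_map (F (Suc t)) c - list_chain_map (F t) c"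
    proof (rule discrete_homotopy_step[of c p "F t" "F (Suc t)" X \<delta>])
      show "F t ` set l \<union> F (Suc t) ` set l \<subseteq> X" if "l \<in> Poly_Mapping.keys c" for l
        using that keys F(3) Suc.prems by fastforce
      show "dist x y < \<delta>" if "l \<in> Poly_Mapping.keys c" "x \<in> F t ` set l \<union> F (Suc t) ` set l"
          "y \<in> F t ` set l \<union> F (Suc t) ` set l" for l x y
        using that close[OF that(1)] Suc.prems by auto
    qed (use keys cycle in auto)
    have "Poly_Mapping.keys (b' + b) \<subseteq> {l \<in> small_lists \<delta> X. length l = Suc p}"
      using keys_add[of b' b] b b' by blast
    moreover have "frag_extend list_bd (b' + b) = list_chain_map (F (Suc t)) c - list_chain_map (F 0) c"
      using b b' by (simp add: frag_extend_add)
    ultimately show ?case by blast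
  qed
  then obtain b where b: "Poly_Mapping.keys b \<subseteq> {l \<in> small_lists \<delta> X. length l = Suc p}"
      "frag_extend list_bd b = list_chain_map (F m) c - list_chain_map (F 0) c" by blast
  have "list_chain_map (F 0) c = frag_extend frag_of c"
  proof (rule frag_extend_eq)
    fix l assume "l \<in> Poly_Mapping.keys c"
    then have "map (F 0) l = map id l" using keys F(1) by (intro map_cong) fastforce+
    then show "frag_of (map (F 0) l) = frag_of l" by simp
  qed
  then have F0: "list_chain_map (F 0) c = c" by (simp flip: frag_expansion)
  have "Poly_Mapping.keys (list_chain_map (F m) c) \<subseteq> {b \<in> lists {x0}. length b = p}"
    by (rule keys_frag_extend_subset) (use keys F(2) in fastforce)
  then obtain e where e: "Poly_Mapping.keys e \<subseteq> {b \<in> lists {x0}. length b = Suc p}"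
      "frag_extend list_bd e = list_chain_map (F m) c"
    using acyclic_onD[OF acyclic_on_lists[of x0 "{x0}"], of "list_chain_map (F m) c" p] cycle
    by (auto simp: list_bd_list_chain_map)
  have "lists {x0} \<subseteq> small_lists \<delta> X"
  proof
    fix l assume "l \<in> lists {x0}"
    then have l: "\<forall>x\<in>set l. x = x0" by auto
    then have "dist x y < \<delta>" if "x \<in> set l" "y \<in> set l" for x y
      using that x0(2) by (metis dist_self)
    with l x0(1) show "l \<in> small_lists \<delta> X" by (auto simp: small_lists_def)
  qed
  then have "Poly_Mapping.keys (e - b) \<subseteq> {l \<in> small_lists \<delta> X. length l = Suc p}"
    using keys_diff[of e b] e b by blast
  moreover have "frag_extend list_bd (e - b) = c"
    using e b F0 by (simp add: frag_extend_diff)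
  ultimately show thesis using that by blast
qed

text \<open>The straight-line contraction to a point never increases distances at a fixed time, so
  cycles bound at the same scale \<open>\<delta>\<close>. Only the motion between consecutive times
  costs something, and fine time steps make this cost small.\<close>

lemma acyclic_on_small_lists_convex:
  fixes X :: "'a::real_normed_vector set"
  assumes "convex X" "bounded X" "X \<noteq> {}" "\<delta> > 0"
  shows "acyclic_on list_bd length (small_lists \<delta> X)"
  unfolding acyclic_on_def
proof (intro allI impI)
  fix p and c :: "'a list \<Rightarrow>\<^sub>0 int"
  assume c: "Poly_Mapping.keys c \<subseteq> {b \<in> small_lists \<delta> X. length b = p}" "frag_extend list_bd c = 0"
  obtain x0 where x0: "x0 \<in> X" using assms by blast
  obtain D where D: "\<And>x. x \<in> X \<Longrightarrow> dist x0 x \<le> D" "D > 0"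
  proof -
    obtain D where "\<forall>x\<in>X. dist x0 x \<le> D" using assms(2) bounded_any_center by blast
    then show thesis using that[of "max D 1"] by fastforce
  qed
  \<comment> \<open>A chain involves finitely many tuples, so their distances have a maximum
    strictly below \<open>\<delta>\<close>; the 0 keeps \<open>E\<close> nonempty when no distances
    occur.\<close>
  define E where "E = insert 0 (\<Union>l\<in>Poly_Mapping.keys c. \<Union>x\<in>set l. (\<lambda>y. dist x y) ` set l)"
  have E: "finite E" "E \<noteq> {}" by (auto simp: E_def)
  have "e < \<delta>" if "e \<in> E" for e
    using that c(1) assms(4) by (fastforce simp: E_def small_lists_def)
  with E have E\<delta>: "Max E < \<delta>" by simp
  have dE: "dist x y \<le> Max E" if "l \<in> Poly_Mapping.keys c" "x \<in> set l" "y \<in> set l" for l x y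
    using that E by (intro Max_ge) (auto simp: E_def)
  \<comment> \<open>One time step moves a point by at most \<open>D / m\<close>, which this choice
    fits into the gap between \<open>Max E\<close> and \<open>\<delta>\<close>.\<close>
  obtain m :: nat where m: "m > 0" "D / real m < \<delta> - Max E"
  proof -
    obtain k :: nat where k: "D / (\<delta> - Max E) < real k" using reals_Archimedean2 by blast
    have "0 < D / (\<delta> - Max E)" using D E\<delta> by simp
    then have "k > 0" using k by (metis less_trans of_nat_0_less_iff)
    then show thesis using that[of k] k E\<delta> D by (simp add: field_simps)
  qed
  define F where "F t x = (1 - real t / real m) *\<^sub>R x + (real t / real m) *\<^sub>R x0" for t x
  have *: "dist (F t x) (F t' y) < \<delta>" if "l \<in> Poly_Mapping.keys c" "x \<in> set l" "y \<in> set l"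
    "t \<le> m" "t' \<le> m" "t \<le> Suc t'" "t' \<le> Suc t" for l x y t t'
  proof -
    have yX: "y \<in> X" using that c by (auto simp: small_lists_def)
    have t1: "0 \<le> real t / real m" "real t / real m \<le> 1" using that m by simp_all
    have "dist (F t x) (F t y) = \<bar>1 - real t / real m\<bar> * dist x y"
      by (simp add: F_def dist_norm flip: scaleR_diff_right)
    also have "\<dots> \<le> dist x y" using t1 by (intro mult_left_le_one_le) auto
    also have "\<dots> \<le> Max E" using dE that by blast
    finally have 1: "dist (F t x) (F t y) \<le> Max E" .
    have "F t y - F t' y = ((real t - real t') / real m) *\<^sub>R (x0 - y)"
      by (simp add: F_def algebra_simps diff_divide_distrib)
    then have "dist (F t y) (F t' y) = \<bar>(real t - real t') / real m\<bar> * dist x0 y"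
      by (simp add: dist_norm)
    also have "\<bar>(real t - real t') / real m\<bar> \<le> 1 / real m"
      using that by (auto simp: abs_divide intro!: divide_right_mono)
    then have "\<bar>(real t - real t') / real m\<bar> * dist x0 y \<le> 1 / real m * D"
      using D(1)[OF yX] D(2) m by (intro mult_mono) auto
    finally have "dist (F t y) (F t' y) \<le> D / real m" by simp
    with 1 m show ?thesis using dist_triangle[of "F t x" "F t' y" "F t y"] by linarith
  qed
  obtain b where "Poly_Mapping.keys b \<subseteq> {l \<in> small_lists \<delta> X. length l = Suc p}" "frag_extend list_bd b = c"
  proof (rule discrete_contraction[of c X p F m x0 X \<delta>])
    show "F t x \<in> X" if "x \<in> X" "t \<le> m" for t x
      using that x0 m assms(1) unfolding F_def by (intro convexD) auto
  qed (use c x0 assms m * in \<open>auto simp: small_lists_def F_def\<close>)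
  then show "\<exists>e. Poly_Mapping.keys e \<subseteq> {b \<in> small_lists \<delta> X. length b = Suc p} \<and> frag_extend list_bd e = c"
    by blast
qed

text \<open>A general contraction may stretch distances, so the cycle must be given at a finer scale
  than its filling. Uniform continuity of the contraction on a compact product supplies that
  scale.\<close>

lemma small_cycles_bound_contractible:
  fixes X :: "'a::real_normed_vector set"
  assumes "compact X" "contractible X" "X \<noteq> {}" "\<delta> > 0"
  obtains \<eta> where "\<eta> > 0"
    "\<And>p c. Poly_Mapping.keys c \<subseteq> {l \<in> small_lists \<eta> X. length l = p} \<Longrightarrow> frag_extend list_bd c = 0 \<Longrightarrow>
      \<exists>b. Poly_Mapping.keys b \<subseteq> {l \<in> small_lists \<delta> X. length l = Suc p} \<and> frag_extend list_bd b = c"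
proof -
  obtain a h where h: "continuous_on ({0..1::real} \<times> X) h" "h ` ({0..1} \<times> X) \<subseteq> X"
      "\<And>x. x \<in> X \<Longrightarrow> h (0, x) = x" "\<And>x. x \<in> X \<Longrightarrow> h (1, x) = a"
    using assms(2) by (auto simp: contractible_def homotopic_with image_subset_iff_funcset)
  have "uniformly_continuous_on ({0..1} \<times> X) h"
    by (intro compact_uniformly_continuous h compact_Times) (use assms in auto)
  then obtain \<eta> where \<eta>: "\<eta> > 0" "\<And>u v. u \<in> {0..1} \<times> X \<Longrightarrow> v \<in> {0..1} \<times> X \<Longrightarrow> dist u v < \<eta> \<Longrightarrow> dist (h u) (h v) < \<delta>"
    unfolding uniformly_continuous_on_def using assms(4) by metis
  obtain m :: nat where m: "m > 0" "1 / real m < \<eta> / 2"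
  proof -
    obtain m where "m > 0" "inverse (real m) < \<eta> / 2"
      using \<eta>(1) by (metis half_gt_zero ex_inverse_of_nat_less)
    then show thesis using that by (simp add: inverse_eq_divide)
  qed
  show thesis
  proof
    \<comment> \<open>One half of \<open>\<eta>\<close> is spent on the distance of points, the
      other on the time step \<open>1 / m\<close>.\<close>
    show "\<eta> / 2 > 0" using \<eta> by simp
    fix p and c :: "'a list \<Rightarrow>\<^sub>0 int"
    assume c: "Poly_Mapping.keys c \<subseteq> {l \<in> small_lists (\<eta> / 2) X. length l = p}" "frag_extend list_bd c = 0"
    define F where "F t x = h (real t / real m, x)" for t x
    have *: "dist (F t x) (F t' y) < \<delta>" if "l \<in> Poly_Mapping.keys c" "x \<in> set l" "y \<in> set l"
      "t \<le> m" "t' \<le> m" "t \<le> Suc t'" "t' \<le> Suc t" for l x y t t'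
      unfolding F_def
    proof (rule \<eta>(2))
      have l: "x \<in> X" "y \<in> X" "dist x y < \<eta> / 2" using that c by (auto simp: small_lists_def)
      then show "(real t / real m, x) \<in> {0..1} \<times> X" "(real t' / real m, y) \<in> {0..1} \<times> X"
        using that m by auto
      have "dist (real t / real m) (real t' / real m) = \<bar>(real t - real t') / real m\<bar>"
        by (simp add: dist_real_def diff_divide_distrib)
      also have "\<dots> \<le> 1 / real m"
        using that by (auto simp: abs_divide intro!: divide_right_mono)
      finally have "dist (real t / real m) (real t' / real m) < \<eta> / 2" using m by simp
      moreover have "dist (real t / real m, x) (real t' / real m, y) \<le> dist (real t / real m) (real t' / real m) + dist x y"
        unfolding dist_Pair_Pair using sqrt_sum_squares_le_sum by (metis zero_le_dist)
      ultimately show "dist (real t / real m, x) (real t' / real m, y) < \<eta>" using l by linarith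
    qed
    have FX: "F t x \<in> X" if "x \<in> X" "t \<le> m" for t x
      using that h(2) m unfolding F_def by (force simp: image_subset_iff)
    obtain x1 where "x1 \<in> X" using assms by blast
    then have "a \<in> X" using FX[of x1 m] h(4) m by (simp add: F_def)
    obtain b where "Poly_Mapping.keys b \<subseteq> {l \<in> small_lists \<delta> X. length l = Suc p}" "frag_extend list_bd b = c"
      by (rule discrete_contraction[of c X p F m a X \<delta>])
        (use c \<open>a \<in> X\<close> assms m h * FX in \<open>auto simp: small_lists_def F_def\<close>)
    then show "\<exists>b. Poly_Mapping.keys b \<subseteq> {l \<in> small_lists \<delta> X. length l = Suc p} \<and> frag_extend list_bd b = c"
      by blast
  qed
qed

subsection \<open>Oriented simplicial chains\<close>

text \<open>The finitely supported counterpart of \<open>bdry_coeff\<close>, which makes the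
  \<open>frag_extend\<close> calculus available; a vertex has boundary the empty face.\<close>

definition face_bd :: "'v::{finite,linorder} set \<Rightarrow> 'v set \<Rightarrow>\<^sub>0 int" where
  "face_bd \<sigma> = (\<Sum>v\<in>\<sigma>. frag_cmul ((-1) ^ card {w\<in>\<sigma>. w < v}) (frag_of (\<sigma> - {v})))"

lemma lookup_face_bd: "Poly_Mapping.lookup (face_bd \<sigma>) \<tau> = bdry_coeff \<sigma> \<tau>"
proof -
  have sum: "Poly_Mapping.lookup (face_bd \<sigma>) \<tau> = (\<Sum>v\<in>\<sigma>. if \<sigma> - {v} = \<tau> then (-1) ^ card {w\<in>\<sigma>. w < v} else 0)"
    by (auto simp: face_bd_def lookup_sum lookup_single when_def intro!: sum.cong)
  show ?thesis
  proof (cases "\<tau> \<subseteq> \<sigma> \<and> card \<sigma> = Suc (card \<tau>)")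
    case True
    then have "card (\<sigma> - \<tau>) = 1" by (simp add: card_Diff_subset)
    then obtain v where v: "\<sigma> - \<tau> = {v}" by (rule card_1_singletonE)
    then have "\<sigma> - {u} = \<tau> \<longleftrightarrow> u = v" if "u \<in> \<sigma>" for u using True that by blast
    then have "Poly_Mapping.lookup (face_bd \<sigma>) \<tau> = (\<Sum>u\<in>\<sigma>. if u = v then (-1) ^ card {w\<in>\<sigma>. w < v} else 0)"
      unfolding sum by (intro sum.cong) auto
    then show ?thesis using True v by (auto simp: bdry_coeff_def)
  next
    case False
    then have "\<sigma> - {v} \<noteq> \<tau>" if "v \<in> \<sigma>" for v
      using that card_Suc_Diff1[of \<sigma> v] by auto
    then show ?thesis unfolding sum bdry_coeff_def using False by (auto intro!: sum.neutral)
  qed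
qed

lemma keys_face_bd: "Poly_Mapping.keys (face_bd \<sigma>) \<subseteq> {\<tau>. \<tau> \<subseteq> \<sigma> \<and> Suc (card \<tau>) = card \<sigma>}"
  by (auto simp: in_keys_iff lookup_face_bd bdry_coeff_def split: if_splits)

abbreviation face_cone :: "'v \<Rightarrow> ('v set \<Rightarrow>\<^sub>0 int) \<Rightarrow> 'v set \<Rightarrow>\<^sub>0 int" where
  "face_cone m \<equiv> frag_extend (\<lambda>\<tau>. frag_of (insert m \<tau>))"

text \<open>A new least vertex has sign +1 itself and shifts the position of every other vertex by
  one, which flips all other signs.\<close>

lemma face_bd_insert_min:
  assumes m: "\<forall>x\<in>\<sigma>. m < x"
  shows "face_bd (insert m \<sigma>) = frag_of \<sigma> - face_cone m (face_bd \<sigma>)"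
proof -
  have m': "m \<notin> \<sigma>" using m by blast
  have *: "{w \<in> insert m \<sigma>. w < m} = {}" "insert m \<sigma> - {m} = \<sigma>"
    using m m' by (auto dest: less_asym)
  have **: "card {w \<in> insert m \<sigma>. w < v} = Suc (card {w \<in> \<sigma>. w < v})"
      "insert m \<sigma> - {v} = insert m (\<sigma> - {v})" if "v \<in> \<sigma>" for v
  proof -
    have "{w \<in> insert m \<sigma>. w < v} = insert m {w \<in> \<sigma>. w < v}" using m that by auto
    then show "card {w \<in> insert m \<sigma>. w < v} = Suc (card {w \<in> \<sigma>. w < v})" using m' by simp
    show "insert m \<sigma> - {v} = insert m (\<sigma> - {v})" using m' that by auto
  qed
  have "face_bd (insert m \<sigma>) = frag_of \<sigma> + 
      (\<Sum>v\<in>\<sigma>. frag_cmul ((-1) ^ card {w\<in>insert m \<sigma>. w < v}) (frag_of (insert m \<sigma> - {v})))"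
    unfolding face_bd_def by (simp only: sum.insert[OF finite m'] * card.empty power_0 frag_cmul_one)
  also have "\<dots> = frag_of \<sigma> - (\<Sum>v\<in>\<sigma>. frag_cmul ((-1) ^ card {w\<in>\<sigma>. w < v}) (frag_of (insert m (\<sigma> - {v}))))"
  proof -
    have "frag_cmul ((-1) ^ card {w\<in>insert m \<sigma>. w < v}) (frag_of (insert m \<sigma> - {v})) =
        - frag_cmul ((-1) ^ card {w\<in>\<sigma>. w < v}) (frag_of (insert m (\<sigma> - {v})))" if "v \<in> \<sigma>" for v
      unfolding **[OF that] by simp
    then show ?thesis by (simp only: sum_negf diff_conv_add_uminus cong: sum.cong)
  qed
  finally show ?thesis
    by (simp add: face_bd_def frag_extend_sum frag_extend_cmul)
qed

lemma face_bd_face_cone: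
  assumes "\<And>\<tau>. \<tau> \<in> Poly_Mapping.keys c \<Longrightarrow> \<forall>x\<in>\<tau>. m < x"
  shows "frag_extend face_bd (face_cone m c) = c - face_cone m (frag_extend face_bd c)"
proof -
  have "frag_extend face_bd (face_cone m c) = frag_extend (\<lambda>\<tau>. frag_of \<tau> - face_cone m (face_bd \<tau>)) c"
    unfolding frag_extend_frag_extend 
    by (rule frag_extend_eq) (use assms in \<open>simp add: face_bd_insert_min\<close>)
  then show ?thesis
    by (simp add: frag_extend_diff_fun frag_extend_frag_extend flip: frag_expansion)
qed

lemma face_bd_empty [simp]: "face_bd {} = 0"
  by (simp add: face_bd_def)

text \<open>Building the face by adding ever smaller vertices makes each step a cone, so the cone
  formula carries the induction.\<close>

lemma face_bd_face_bd: "frag_extend face_bd (face_bd \<sigma>) = 0"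
proof (induction \<sigma> rule: finite_linorder_min_induct[OF finite])
  case (2 m \<sigma>)
  have "frag_extend face_bd (face_cone m (face_bd \<sigma>)) = face_bd \<sigma> - face_cone m (frag_extend face_bd (face_bd \<sigma>))"
    by (rule face_bd_face_cone) (use 2 keys_face_bd in blast)
  with 2 show ?case by (simp add: face_bd_insert_min frag_extend_diff)
qed simp

text \<open>Coning at the least vertex of \<open>V\<close> avoids all sorting signs. Faces that
  already contain this vertex are sent to 0, which still satisfies the homotopy identity
  \<open>hom\<close>.\<close>

lemma acyclic_on_simplex:
  assumes "V \<noteq> {}"
  shows "acyclic_on face_bd card (Pow V)"
  unfolding acyclic_on_def
proof (intro allI impI)
  fix p and c :: "'a set \<Rightarrow>\<^sub>0 int"
  assume c: "Poly_Mapping.keys c \<subseteq> {b \<in> Pow V. card b = p}" "frag_extend face_bd c = 0"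
  define m where "m = Min V"
  have m: "m \<in> V" "\<And>v. v \<in> V \<Longrightarrow> v \<noteq> m \<Longrightarrow> m < v"
    using assms unfolding m_def by (auto simp: order_less_le)
  define k where "k \<tau> = (if m \<in> \<tau> then 0 else frag_of (insert m \<tau>))" for \<tau>
  have hom: "frag_extend face_bd (k \<tau>) = frag_of \<tau> - frag_extend k (face_bd \<tau>)" if \<tau>: "\<tau> \<subseteq> V" for \<tau>
  proof (cases "m \<in> \<tau>")
    case True
    define \<rho> where "\<rho> = \<tau> - {m}"
    have \<rho>: "\<tau> = insert m \<rho>" "m \<notin> \<rho>" "\<forall>x\<in>\<rho>. m < x"
      using True \<tau> m(2) by (auto simp: \<rho>_def)
    have "frag_extend k (face_cone m (face_bd \<rho>)) = 0"
      unfolding frag_extend_frag_extend by (rule frag_extend_eq_0) (simp add: k_def)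
    with \<rho> show ?thesis by (simp add: face_bd_insert_min frag_extend_diff k_def)
  next
    case False
    then have "\<forall>x\<in>\<tau>. m < x" using \<tau> m(2) by blast
    moreover have "frag_extend k (face_bd \<tau>) = face_cone m (face_bd \<tau>)"
      by (rule frag_extend_eq) (use False keys_face_bd in \<open>auto simp: k_def\<close>)
    ultimately show ?thesis using False by (simp add: k_def face_bd_insert_min)
  qed
  have "Poly_Mapping.keys (frag_extend k c) \<subseteq> {b \<in> Pow V. card b = Suc p}"
    by (rule keys_frag_extend_subset) (use c m in \<open>auto simp: k_def\<close>)
  moreover have "frag_extend face_bd (frag_extend k c) = frag_extend (\<lambda>\<tau>. frag_of \<tau> - frag_extend k (face_bd \<tau>)) c"
    unfolding frag_extend_frag_extend by (rule frag_extend_eq) (use c hom in auto)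
  then have "frag_extend face_bd (frag_extend k c) = c"
    using c(2) by (simp add: frag_extend_diff_fun flip: frag_extend_frag_extend frag_expansion)
  ultimately show "\<exists>e. Poly_Mapping.keys e \<subseteq> {b \<in> Pow V. card b = Suc p} \<and> frag_extend face_bd e = c"
    by blast
qed

section \<open>Barycentric coordinates on the geometric realization\<close>

lemma convex_hull_axis:
  fixes \<sigma> :: "'v::finite set"
  shows "convex hull ((\<lambda>v. axis v (1::real)) ` \<sigma>) =
    {x. (\<forall>v. 0 \<le> x $ v) \<and> (\<forall>v. v \<notin> \<sigma> \<longrightarrow> x $ v = 0) \<and> (\<Sum>v\<in>UNIV. x $ v) = 1}" (is "_ = ?R")
proof
  have "convex ?R"
    unfolding convex_def
    by (auto simp: sum.distrib simp flip: sum_distrib_left intro: add_nonneg_nonneg)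
  moreover have "(\<lambda>v. axis v 1) ` \<sigma> \<subseteq> ?R"
    by (auto simp: axis_def)
  ultimately show "convex hull ((\<lambda>v. axis v 1) ` \<sigma>) \<subseteq> ?R"
    by (rule hull_minimal[rotated])
  show "?R \<subseteq> convex hull ((\<lambda>v. axis v 1) ` \<sigma>)"
  proof
    fix x assume x: "x \<in> ?R"
    have eq: "x = (\<Sum>v\<in>\<sigma>. x $ v *\<^sub>R axis v 1)"
    proof (rule vec_eq_iff[THEN iffD2], rule allI)
      fix w
      have "(\<Sum>v\<in>\<sigma>. x $ v *\<^sub>R axis v 1) $ w = (\<Sum>v\<in>\<sigma>. if v = w then x $ w else 0)"
        unfolding sum_component by (rule sum.cong) (auto simp: axis_def)
      then show "x $ w = (\<Sum>v\<in>\<sigma>. x $ v *\<^sub>R axis v 1) $ w" using x by auto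
    qed
    have "(\<Sum>v\<in>\<sigma>. x $ v) = (\<Sum>v\<in>UNIV. x $ v)"
      by (rule sum.mono_neutral_left) (use x in auto)
    then show "x \<in> convex hull ((\<lambda>v. axis v 1) ` \<sigma>)"
      by (subst eq, intro convex_sum) (use x in \<open>auto intro: hull_inc\<close>)
  qed
qed

text \<open>The support of a point is contained in any simplex through that point and spans the
  smallest one, so questions about the realization reduce to whether a support is a face.\<close>

lemma mem_geom_realization:
  assumes "simplicial_complex \<Delta>"
  shows "x \<in> geom_realization \<Delta> \<longleftrightarrow> (\<forall>v. 0 \<le> x $ v) \<and> (\<Sum>v\<in>UNIV. x $ v) = 1 \<and> {v. x $ v \<noteq> 0} \<in> \<Delta>"
proof
  assume "x \<in> geom_realization \<Delta>"
  then obtain \<sigma> where "\<sigma> \<in> \<Delta>" "x \<in> convex hull ((\<lambda>v. axis v 1) ` \<sigma>)"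
    by (auto simp: geom_realization_def)
  moreover from this have "{v. x $ v \<noteq> 0} \<subseteq> \<sigma>" by (auto simp: convex_hull_axis)
  ultimately show "(\<forall>v. 0 \<le> x $ v) \<and> (\<Sum>v\<in>UNIV. x $ v) = 1 \<and> {v. x $ v \<noteq> 0} \<in> \<Delta>"
    using assms by (auto simp: convex_hull_axis simplicial_complex_def)
next
  assume "(\<forall>v. 0 \<le> x $ v) \<and> (\<Sum>v\<in>UNIV. x $ v) = 1 \<and> {v. x $ v \<noteq> 0} \<in> \<Delta>"
  then show "x \<in> geom_realization \<Delta>"
    unfolding geom_realization_def convex_hull_axis by blast
qed

lemma compact_geom_realization: "compact (geom_realization \<Delta>)"
  unfolding geom_realization_def
  by (intro compact_UN finite compact_convex_hull finite_imp_compact) auto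

text \<open>Three carriers are used: \<open>\<psi>\<close> turns faces into fine tuples,
  \<open>\<Phi>\<close> turns \<open>\<delta>\<close>-small tuples into faces, and \<open>H\<close>
  joins the composite to the identity. A cycle \<open>c\<close> is filled by applying
  \<open>\<Phi>\<close> to a filling of the tuple cycle \<open>\<psi>\<close> of \<open>c\<close>
  and correcting with \<open>H\<close>.\<close>

lemma acyclic_on_contractible_complex:
  fixes \<Delta> :: "'v::{finite,linorder} set set"
  assumes \<Delta>: "simplicial_complex \<Delta>"
    and "contractible (geom_realization \<Delta>)" "geom_realization \<Delta> \<noteq> {}"
  shows "acyclic_on face_bd card \<Delta>"
  unfolding acyclic_on_def
proof (intro allI impI)
  fix p and c :: "'v set \<Rightarrow>\<^sub>0 int"
  assume c: "Poly_Mapping.keys c \<subseteq> {b \<in> \<Delta>. card b = p}" "frag_extend face_bd c = 0"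
  let ?hull = "\<lambda>\<sigma>::'v set. convex hull ((\<lambda>v. axis v (1::real)) ` \<sigma>)"
  let ?X = "geom_realization \<Delta>"
  \<comment> \<open>Nonnegative or not, coordinates with sum 1 include one that is at least the
    average \<open>1 / CARD('v)\<close>.\<close>
  define \<delta> where "\<delta> = 1 / real CARD('v)"
  have \<delta>: "\<delta> > 0" by (simp add: \<delta>_def)
  obtain \<eta>0 where \<eta>0: "\<eta>0 > 0"
    "\<And>p c. Poly_Mapping.keys c \<subseteq> {l \<in> small_lists \<eta>0 ?X. length l = p} \<Longrightarrow> frag_extend list_bd c = 0 \<Longrightarrow>
      \<exists>b. Poly_Mapping.keys b \<subseteq> {l \<in> small_lists \<delta> ?X. length l = Suc p} \<and> frag_extend list_bd b = c"
    using small_cycles_bound_contractible[OF compact_geom_realization assms(2,3) \<delta>] by blast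
  \<comment> \<open>Tuples produced by \<open>\<psi>\<close> must be fine enough both for the
    contraction (\<open>\<eta>0\<close>) and for \<open>\<Phi>\<close>
    (\<open>\<delta>\<close>).\<close>
  define \<eta> where "\<eta> = min \<eta>0 \<delta>"
  have \<eta>: "\<eta> > 0" "\<eta> \<le> \<eta>0" "\<eta> \<le> \<delta>" using \<eta>0 \<delta> by (auto simp: \<eta>_def)
  define \<phi> where "\<phi> x = (SOME v. x $ v \<ge> \<delta>)" for x :: "(real, 'v) vec"
  have \<phi>: "x $ \<phi> x \<ge> \<delta>" if "(\<Sum>v\<in>UNIV. x $ v) = 1" for x
  proof -
    have "\<exists>v. x $ v \<ge> \<delta>"
    proof (rule ccontr)
      assume "\<not> ?thesis"
      then have "(\<Sum>v\<in>UNIV. x $ v) < (\<Sum>v\<in>(UNIV::'v set). \<delta>)"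
        by (intro sum_strict_mono) (auto simp: not_le)
      with that show False by (simp add: \<delta>_def)
    qed
    then show ?thesis unfolding \<phi>_def by (rule someI_ex)
  qed
  have \<phi>_hull: "\<phi> ` ?hull \<sigma> \<subseteq> \<sigma>" for \<sigma>
    using \<phi> \<delta> by (fastforce simp: convex_hull_axis)
  have hull_X: "?hull \<sigma> \<subseteq> ?X" if "\<sigma> \<in> \<Delta>" for \<sigma>
    using that by (auto simp: geom_realization_def)
  \<comment> \<open>Coordinate \<open>\<phi> x\<close> is at least \<open>\<delta>\<close> at
    \<open>x\<close> and changes by less than \<open>\<delta>\<close> on passing to
    \<open>hd l\<close>, so it does not vanish there. All chosen vertices thus lie in the support of
    the single point \<open>hd l\<close>, which is a face.\<close>
  have \<phi>_face: "Pow (\<phi> ` set l) \<subseteq> \<Delta>" if l: "l \<in> small_lists \<delta> ?X" "l \<noteq> []" for l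
  proof -
    have hd: "hd l \<in> ?X" using l by (auto simp: small_lists_def)
    have "hd l $ \<phi> x \<noteq> 0" if "x \<in> set l" for x
    proof -
      have "x \<in> ?X" "dist x (hd l) < \<delta>" using that l by (auto simp: small_lists_def)
      then have "x $ \<phi> x \<ge> \<delta>" using \<phi> by (simp add: mem_geom_realization[OF \<Delta>])
      moreover have "\<bar>(x - hd l) $ \<phi> x\<bar> < \<delta>"
        using component_le_norm_cart[of "x - hd l" "\<phi> x"] \<open>dist x (hd l) < \<delta>\<close> by (simp add: dist_norm)
      ultimately show ?thesis by auto
    qed
    then have "\<phi> ` set l \<subseteq> {v. hd l $ v \<noteq> 0}" by blast
    moreover have "{v. hd l $ v \<noteq> 0} \<in> \<Delta>" using hd by (simp add: mem_geom_realization[OF \<Delta>])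
    ultimately show ?thesis using \<Delta> unfolding simplicial_complex_def by blast
  qed
  have sub\<Delta>: "\<tau> \<in> \<Delta>" if "\<sigma> \<in> \<Delta>" "\<tau> \<subseteq> \<sigma>" for \<sigma> \<tau>
    using that \<Delta> unfolding simplicial_complex_def by blast
  have keys_\<Delta>: "Poly_Mapping.keys (face_bd \<sigma>) \<subseteq> {b \<in> \<Delta>. Suc (card b) = card \<sigma>}" if "\<sigma> \<in> \<Delta>" for \<sigma>
    using keys_face_bd[of \<sigma>] sub\<Delta>[OF that] by blast
  \<comment> \<open>Over the empty face the hull is empty and the carrier contains only the empty
    tuple; it is not acyclic, so the value in rank 0 is prescribed.\<close>
  obtain \<psi> where \<psi>:
    "\<And>\<sigma>. \<sigma> \<in> \<Delta> \<Longrightarrow> Poly_Mapping.keys (\<psi> \<sigma>) \<subseteq> {l \<in> small_lists \<eta> (?hull \<sigma>). length l = card \<sigma> + 0}"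
    "\<And>\<sigma>. \<sigma> \<in> \<Delta> \<Longrightarrow> frag_extend list_bd (\<psi> \<sigma>) = 0 + frag_cmul 1 (frag_extend \<psi> (face_bd \<sigma>))"
    "\<And>\<sigma>. \<sigma> \<in> \<Delta> \<Longrightarrow> card \<sigma> = 0 \<Longrightarrow> \<psi> \<sigma> = frag_of []"
  proof (rule acyclic_carrier[of \<Delta> face_bd card "\<lambda>\<sigma>. small_lists \<eta> (?hull \<sigma>)" list_bd length "\<lambda>_. frag_of []" 0 "\<lambda>_. 0" 1])
    show "small_lists \<eta> (?hull \<tau>) \<subseteq> small_lists \<eta> (?hull \<sigma>)" if "\<tau> \<in> Poly_Mapping.keys (face_bd \<sigma>)" for \<sigma> \<tau>
    proof -
      have "\<tau> \<subseteq> \<sigma>" using that keys_face_bd by blast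
      then have "?hull \<tau> \<subseteq> ?hull \<sigma>" by (intro hull_mono) blast
      then show ?thesis by (auto simp: small_lists_def)
    qed
    show "acyclic_on list_bd length (small_lists \<eta> (?hull \<sigma>))" if "0 < card \<sigma>" for \<sigma>
      using that \<eta>(1)
      by (intro acyclic_on_small_lists_convex convex_convex_hull bounded_convex_hull finite_imp_bounded) auto
  qed (use keys_\<Delta> in \<open>auto simp: face_bd_face_bd small_lists_def frag_extend_eq_0\<close>)
  \<comment> \<open>The carrier is the full simplex on the chosen vertices, which is acyclic; by
    \<open>\<phi>_face\<close> it lies in \<open>\<Delta>\<close> for nonempty tuples.\<close>
  obtain \<Phi> where \<Phi>:
    "\<And>l. l \<in> small_lists \<delta> ?X \<Longrightarrow> Poly_Mapping.keys (\<Phi> l) \<subseteq> {\<sigma> \<in> Pow (\<phi> ` set l). card \<sigma> = length l + 0}"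
    "\<And>l. l \<in> small_lists \<delta> ?X \<Longrightarrow> frag_extend face_bd (\<Phi> l) = 0 + frag_cmul 1 (frag_extend \<Phi> (list_bd l))"
    "\<And>l. l \<in> small_lists \<delta> ?X \<Longrightarrow> length l = 0 \<Longrightarrow> \<Phi> l = frag_of {}"
  proof (rule acyclic_carrier[of "small_lists \<delta> ?X" list_bd length "\<lambda>l. Pow (\<phi> ` set l)" face_bd card "\<lambda>_. frag_of {}" 0 "\<lambda>_. 0" 1])
    show "Poly_Mapping.keys (list_bd l) \<subseteq> {b \<in> small_lists \<delta> ?X. Suc (length b) = length l}" if "l \<in> small_lists \<delta> ?X" for l
      using keys_list_bd[of l] that by (fastforce simp: small_lists_def)
    show "Pow (\<phi> ` set k) \<subseteq> Pow (\<phi> ` set l)" if "k \<in> Poly_Mapping.keys (list_bd l)" for k l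
      using keys_list_bd[of l] that by blast
    show "acyclic_on face_bd card (Pow (\<phi> ` set l))" if "0 < length l" for l
      using that by (intro acyclic_on_simplex) auto
  qed (auto simp: list_bd_list_bd frag_extend_eq_0)
  have \<psi>_small: "l \<in> small_lists \<delta> ?X" "l \<in> small_lists \<eta>0 ?X" "\<phi> ` set l \<subseteq> \<sigma>" "length l = card \<sigma>"
    if "\<sigma> \<in> \<Delta>" "l \<in> Poly_Mapping.keys (\<psi> \<sigma>)" for \<sigma> l
  proof -
    have l: "set l \<subseteq> ?hull \<sigma>" "length l = card \<sigma>" "\<And>x y. x \<in> set l \<Longrightarrow> y \<in> set l \<Longrightarrow> dist x y < \<eta>"
      using \<psi>(1)[OF that(1)] that(2) by (auto simp: small_lists_def)
    then show "\<phi> ` set l \<subseteq> \<sigma>" "length l = card \<sigma>" using \<phi>_hull by blast+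
    show "l \<in> small_lists \<delta> ?X" "l \<in> small_lists \<eta>0 ?X"
      using l hull_X[OF that(1)] \<eta> unfolding small_lists_def by (auto intro: less_le_trans)
  qed
  have \<Phi>\<psi>: "frag_extend face_bd (frag_extend \<Phi> (\<psi> \<sigma>)) = frag_extend (\<lambda>\<sigma>. frag_extend \<Phi> (\<psi> \<sigma>)) (face_bd \<sigma>)" if "\<sigma> \<in> \<Delta>" for \<sigma>
  proof -
    have "frag_extend face_bd (frag_extend \<Phi> (\<psi> \<sigma>)) = frag_extend (\<lambda>l. frag_extend \<Phi> (list_bd l)) (\<psi> \<sigma>)"
      unfolding frag_extend_frag_extend by (rule frag_extend_eq) (use \<Phi>(2) \<psi>_small[OF that] in simp)
    then show ?thesis using \<psi>(2)[OF that] by (simp flip: frag_extend_frag_extend)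
  qed
  let ?u = "\<lambda>\<sigma>. frag_of \<sigma> - frag_extend \<Phi> (\<psi> \<sigma>)"
  \<comment> \<open>The composite of \<open>\<psi>\<close> and \<open>\<Phi>\<close> and the
    identity are both carried by the simplex on \<open>\<sigma>\<close> and agree on the empty face,
    so they are chain homotopic.\<close>
  obtain H where H:
    "\<And>\<sigma>. \<sigma> \<in> \<Delta> \<Longrightarrow> Poly_Mapping.keys (H \<sigma>) \<subseteq> {\<tau> \<in> Pow \<sigma>. card \<tau> = card \<sigma> + 1}"
    "\<And>\<sigma>. \<sigma> \<in> \<Delta> \<Longrightarrow> frag_extend face_bd (H \<sigma>) = ?u \<sigma> + frag_cmul (- 1) (frag_extend H (face_bd \<sigma>))"
  proof (rule acyclic_carrier[of \<Delta> face_bd card Pow face_bd card "\<lambda>_. 0" 1 ?u "- 1"])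
    show "Pow \<tau> \<subseteq> Pow \<sigma>" if "\<tau> \<in> Poly_Mapping.keys (face_bd \<sigma>)" for \<sigma> \<tau> :: "'v set"
      using that keys_face_bd by blast
    show "acyclic_on face_bd card (Pow \<sigma>)" if "0 < card \<sigma>" for \<sigma> :: "'v set"
      using that by (intro acyclic_on_simplex) auto
    show "frag_extend face_bd 0 = ?u \<sigma>" if "\<sigma> \<in> \<Delta>" "card \<sigma> = 0" for \<sigma>
      using that \<psi>(3)[OF that] \<Phi>(3)[of "[]"] by (simp add: small_lists_def)
    show "Poly_Mapping.keys (?u \<sigma>) \<subseteq> {\<tau> \<in> Pow \<sigma>. Suc (card \<tau>) = card \<sigma> + 1}" if "\<sigma> \<in> \<Delta>" for \<sigma>
    proof -
      have "Poly_Mapping.keys (frag_extend \<Phi> (\<psi> \<sigma>)) \<subseteq> {\<tau> \<in> Pow \<sigma>. Suc (card \<tau>) = card \<sigma> + 1}"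
        by (rule keys_frag_extend_subset) (use \<psi>_small[OF that] \<Phi>(1) in fastforce)
      then show ?thesis using keys_diff[of "frag_of \<sigma>" "frag_extend \<Phi> (\<psi> \<sigma>)"] by fastforce
    qed
    show "frag_extend face_bd (?u \<sigma>) = frag_cmul (- (- 1)) (frag_extend ?u (face_bd \<sigma>))" if "\<sigma> \<in> \<Delta>" for \<sigma>
      using \<Phi>\<psi>[OF that] by (simp add: frag_extend_diff frag_extend_diff_fun flip: frag_expansion)
  qed (use keys_\<Delta> in \<open>auto simp: face_bd_face_bd\<close>)
  have c\<Delta>: "\<sigma> \<in> \<Delta>" "card \<sigma> = p" if "\<sigma> \<in> Poly_Mapping.keys c" for \<sigma> using c(1) that by auto
  have "frag_extend list_bd (frag_extend \<psi> c) = frag_extend (\<lambda>\<sigma>. frag_extend \<psi> (face_bd \<sigma>)) c"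
    unfolding frag_extend_frag_extend by (rule frag_extend_eq) (simp add: \<psi>(2) c\<Delta>)
  then have "frag_extend list_bd (frag_extend \<psi> c) = 0"
    using c(2) by (simp flip: frag_extend_frag_extend)
  moreover have "Poly_Mapping.keys (frag_extend \<psi> c) \<subseteq> {l \<in> small_lists \<eta>0 ?X. length l = p}"
    by (rule keys_frag_extend_subset) (use \<psi>_small(2,4)[OF c\<Delta>(1)] c\<Delta>(2) in auto)
  ultimately obtain b where b: "Poly_Mapping.keys b \<subseteq> {l \<in> small_lists \<delta> ?X. length l = Suc p}"
      "frag_extend list_bd b = frag_extend \<psi> c"
    using \<eta>0(2) by blast
  \<comment> \<open>The first summand has boundary
    \<open>frag_extend \<Phi> (frag_extend \<psi> c)\<close>, the second has the difference between
    \<open>c\<close> and that chain.\<close>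
  let ?e = "frag_extend \<Phi> b + frag_extend H c"
  have "frag_extend face_bd (frag_extend \<Phi> b) = frag_extend (\<lambda>l. frag_extend \<Phi> (list_bd l)) b"
    unfolding frag_extend_frag_extend by (rule frag_extend_eq) (use \<Phi>(2) b(1) in auto)
  then have 1: "frag_extend face_bd (frag_extend \<Phi> b) = frag_extend \<Phi> (frag_extend \<psi> c)"
    using b(2) by (simp flip: frag_extend_frag_extend)
  have "frag_extend face_bd (frag_extend H c) = frag_extend (\<lambda>\<sigma>. ?u \<sigma> - frag_extend H (face_bd \<sigma>)) c"
    unfolding frag_extend_frag_extend[of face_bd H] by (rule frag_extend_eq) (use H(2) c\<Delta> in simp)
  also have "\<dots> = c - frag_extend \<Phi> (frag_extend \<psi> c)"
    using c(2) by (simp add: frag_extend_diff_fun flip: frag_extend_frag_extend frag_expansion)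
  finally have "frag_extend face_bd ?e = c" using 1 by (simp add: frag_extend_add)
  moreover have "Poly_Mapping.keys (frag_extend \<Phi> b) \<subseteq> {\<sigma> \<in> \<Delta>. card \<sigma> = Suc p}"
  proof (rule keys_frag_extend_subset)
    fix l assume "l \<in> Poly_Mapping.keys b"
    then have "l \<in> small_lists \<delta> ?X" "length l = Suc p" using b by auto
    moreover from this have "Pow (\<phi> ` set l) \<subseteq> \<Delta>" by (intro \<phi>_face) auto
    ultimately show "Poly_Mapping.keys (\<Phi> l) \<subseteq> {\<sigma> \<in> \<Delta>. card \<sigma> = Suc p}" using \<Phi>(1)[of l] by auto
  qed
  moreover have "Poly_Mapping.keys (frag_extend H c) \<subseteq> {\<sigma> \<in> \<Delta>. card \<sigma> = Suc p}"
  proof (rule keys_frag_extend_subset)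
    fix \<sigma> assume \<sigma>: "\<sigma> \<in> Poly_Mapping.keys c"
    show "Poly_Mapping.keys (H \<sigma>) \<subseteq> {\<sigma> \<in> \<Delta>. card \<sigma> = Suc p}"
      using H(1)[OF c\<Delta>(1)[OF \<sigma>]] sub\<Delta>[OF c\<Delta>(1)[OF \<sigma>]] c\<Delta>(2)[OF \<sigma>] by auto
  qed
  ultimately show "\<exists>e. Poly_Mapping.keys e \<subseteq> {\<sigma> \<in> \<Delta>. card \<sigma> = Suc p} \<and> frag_extend face_bd e = c"
    using keys_add[of "frag_extend \<Phi> b" "frag_extend H c"] by blast
qed

subsection \<open>Triangulated spheres\<close>

lemma affine_independent_axis: "\<not> affine_dependent ((\<lambda>v. axis v (1::real)) ` \<sigma>)"
proof -
  have "(\<lambda>v. axis v (1::real)) ` \<sigma> \<subseteq> Basis" by (auto simp: Basis_vec_def)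
  then have "independent ((\<lambda>v. axis v (1::real)) ` \<sigma>)"
    using independent_Basis independent_mono by blast
  then show ?thesis using affine_dependent_imp_dependent by blast
qed

definition barycenter :: "'v::finite set \<Rightarrow> (real, 'v) vec" where
  "barycenter \<sigma> = (\<chi> v. if v \<in> \<sigma> then 1 / real (card \<sigma>) else 0)"

lemma barycenter_in_geom_realization:
  assumes "simplicial_complex \<Delta>" "\<sigma> \<in> \<Delta>" "\<sigma> \<noteq> {}"
  shows "barycenter \<sigma> \<in> geom_realization \<Delta>"
proof -
  have "{v. barycenter \<sigma> $ v \<noteq> 0} = \<sigma>"
    using assms by (auto simp: barycenter_def)
  moreover have "(\<Sum>v\<in>UNIV. barycenter \<sigma> $ v) = (\<Sum>v\<in>\<sigma>. 1 / real (card \<sigma>))"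
    by (auto simp: barycenter_def sum.If_cases)
  ultimately show ?thesis
    using assms by (auto simp: mem_geom_realization barycenter_def)
qed

text \<open>Near the barycenter of a maximal face the realization is an open piece of the affine
  hull of that face. The homeomorphism followed by stereographic projection moves this piece to an
  open subset of a hyperplane, and invariance of dimension in both directions equates the two
  dimensions.\<close>

lemma card_maximal_face:
  fixes \<Delta> :: "'v::finite set set"
  assumes \<Delta>: "simplicial_complex \<Delta>"
    and homeo: "geom_realization \<Delta> homeomorphic sphere (0::real^'m::finite) 1"
    and \<sigma>: "\<sigma> \<in> \<Delta>" and max: "\<And>\<tau>. \<tau> \<in> \<Delta> \<Longrightarrow> \<sigma> \<subseteq> \<tau> \<Longrightarrow> \<tau> = \<sigma>"
  shows "card \<sigma> = CARD('m)"
proof -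
  let ?X = "geom_realization \<Delta>" and ?S = "sphere (0::real^'m) 1"
  let ?A = "affine hull ((\<lambda>v. axis v (1::real)) ` \<sigma>)"
  obtain f g where fg: "homeomorphism ?X ?S f g"
    using homeo unfolding homeomorphic_def by blast
  have "?S \<noteq> {}" by simp
  then obtain x where x: "x \<in> ?X" using fg unfolding homeomorphism_def by blast
  have ne: "\<sigma> \<noteq> {}"
  proof
    assume "\<sigma> = {}"
    moreover have "{v. x $ v \<noteq> 0} \<in> \<Delta>" "(\<Sum>v\<in>UNIV. x $ v) = 1" using x by (auto simp: mem_geom_realization[OF \<Delta>])
    ultimately show False using max[of "{v. x $ v \<noteq> 0}"] by auto
  qed
  define b where "b = barycenter \<sigma>"
  have b: "b \<in> ?X" "\<forall>v\<in>\<sigma>. b $ v > 0"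
    using barycenter_in_geom_realization[OF \<Delta> \<sigma> ne] ne by (auto simp: b_def barycenter_def card_gt_0_iff)
  \<comment> \<open>The antipode of \<open>f b\<close> serves as projection center: it lies on the
    sphere and differs from \<open>f b\<close>.\<close>
  define p where "p = - f b"
  have "f b \<in> ?S" using fg b unfolding homeomorphism_def by blast
  then have p: "p \<in> ?S" "f b \<noteq> p" "p \<noteq> 0" by (auto simp: p_def eq_neg_iff_add_eq_0 simp flip: scaleR_2)
  \<comment> \<open>By maximality, a point of the realization that is positive on all of
    \<open>\<sigma>\<close> has support exactly \<open>\<sigma>\<close>.\<close>
  define P where "P = {x::(real,'v) vec. \<forall>v\<in>\<sigma>. x $ v > 0}"
  have "P = (\<Inter>v\<in>\<sigma>. {x. x $ v > 0})" by (auto simp: P_def)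
  then have "open P" by (auto intro!: open_INT open_Collect_less continuous_intros)
  define U where "U = (?X \<inter> f -` (- {p})) \<inter> P"
  have bU: "b \<in> U" using b p by (auto simp: U_def P_def)
  have "openin (top_of_set ?X) (?X \<inter> f -` (- {p}))"
    using fg by (intro continuous_openin_preimage_gen) (auto simp: homeomorphism_def)
  then have openX: "openin (top_of_set ?X) U"
    unfolding U_def using \<open>open P\<close> by (auto simp: openin_open)
  then obtain T where T: "open T" "U = ?X \<inter> T" by (auto simp: openin_open)
  have UP: "U \<subseteq> P" by (auto simp: U_def)
  have A: "?A \<subseteq> {x. (\<forall>v. v \<notin> \<sigma> \<longrightarrow> x $ v = 0) \<and> (\<Sum>v\<in>UNIV. x $ v) = 1}" (is "_ \<subseteq> ?R")
  proof (rule hull_minimal)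
    show "affine ?R" unfolding affine_def
      by (auto simp: sum.distrib simp flip: sum_distrib_left)
    show "(\<lambda>v. axis v 1) ` \<sigma> \<subseteq> ?R" by (auto simp: axis_def)
  qed
  have UA: "U \<subseteq> ?A"
  proof
    fix x assume "x \<in> U"
    then have x: "x \<in> ?X" "x \<in> P" by (auto simp: U_def)
    then have "{v. x $ v \<noteq> 0} = \<sigma>"
      by (intro max) (auto simp: mem_geom_realization[OF \<Delta>] P_def)
    then have "x \<in> convex hull ((\<lambda>v. axis v (1::real)) ` \<sigma>)"
      using x by (auto simp: convex_hull_axis mem_geom_realization[OF \<Delta>])
    then show "x \<in> ?A" using convex_hull_subset_affine_hull by blast
  qed
  \<comment> \<open>A point of the affine hull that is positive on \<open>\<sigma>\<close> already
    lies in the simplex, so relative openness in the realization carries over to the affine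
    hull.\<close>
  have "U = ?A \<inter> (T \<inter> P)"
  proof (intro equalityI subsetI)
    fix x assume x: "x \<in> ?A \<inter> (T \<inter> P)"
    then have "x \<in> ?R" using A by blast
    then have "x \<in> convex hull ((\<lambda>v. axis v (1::real)) ` \<sigma>)"
      using x by (auto simp: convex_hull_axis P_def) (metis less_eq_real_def order_refl)
    then show "x \<in> U" using T x \<sigma> by (auto simp: geom_realization_def)
  qed (use UA UP T in auto)
  then have openA: "openin (top_of_set ?A) U"
    using T \<open>open P\<close> by (auto simp: openin_open)
  have "?S - {p} homeomorphic {x. p \<bullet> x = 0}"
    by (rule homeomorphic_punctured_sphere_hyperplane) (use p in auto)
  then obtain h k where hk: "homeomorphism (?S - {p}) {x. p \<bullet> x = 0} h k"
    unfolding homeomorphic_def by blast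
  have UX: "U \<subseteq> ?X" by (auto simp: U_def)
  have fU: "f ` U \<subseteq> ?S - {p}" using fg unfolding U_def homeomorphism_def by blast
  have homU: "homeomorphism U (h ` f ` U) (h \<circ> f) (g \<circ> k)"
  proof (rule homeomorphism_compose)
    show "homeomorphism U (f ` U) f g" by (rule homeomorphism_of_subsets[OF fg UX order_refl refl])
    show "homeomorphism (f ` U) (h ` f ` U) h k" by (rule homeomorphism_of_subsets[OF hk fU order_refl refl])
  qed
  have hfU: "h ` f ` U \<subseteq> {x. p \<bullet> x = 0}" using hk fU unfolding homeomorphism_def by blast
  have dimA: "aff_dim ?A = int (card \<sigma>) - 1"
  proof -
    have "inj_on (\<lambda>v. axis v (1::real)) \<sigma>" by (auto simp: inj_on_def axis_eq_axis)
    then show ?thesis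
      using aff_dim_affine_independent[OF affine_independent_axis[of \<sigma>]]
      by (simp add: card_image aff_dim_affine_hull)
  qed
  have dimV: "aff_dim {x. p \<bullet> x = 0} = int CARD('m) - 1"
    using p by (simp add: aff_dim_hyperplane)
  have "aff_dim ?A \<le> aff_dim {x. p \<bullet> x = 0}"
  proof (rule invariance_of_dimension_affine_sets[OF openA])
    show "continuous_on U (h \<circ> f)" "inj_on (h \<circ> f) U"
      using homU unfolding homeomorphism_def by (blast, metis inj_on_inverseI)
    show "h \<circ> f \<in> U \<rightarrow> {x. p \<bullet> x = 0}" using hfU by fastforce
    show "U \<noteq> {}" using bU by blast
  qed (auto simp: affine_hyperplane)
  moreover have "aff_dim {x. p \<bullet> x = 0} \<le> aff_dim ?A"
  proof (rule invariance_of_dimension_affine_sets)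
    have "openin (top_of_set ?S) (f ` U)"
      by (rule homeomorphism_imp_open_map[OF fg openX])
    then have "openin (top_of_set (?S - {p})) (f ` U)"
      using fU by (meson Diff_subset openin_subset_trans)
    then show "openin (top_of_set {x. p \<bullet> x = 0}) (h ` f ` U)"
      by (rule homeomorphism_imp_open_map[OF hk])
    show "continuous_on (h ` f ` U) (g \<circ> k)" "inj_on (g \<circ> k) (h ` f ` U)"
      using homU unfolding homeomorphism_def by (blast, metis inj_on_inverseI)
    show "g \<circ> k \<in> h ` f ` U \<rightarrow> ?A" using homU UA unfolding homeomorphism_def by fast
    show "h ` f ` U \<noteq> {}" using bU by blast
  qed (auto simp: affine_hyperplane)
  ultimately show ?thesis using dimA dimV by simp
qed

section \<open>Puncturing the realization inside a maximal face\<close>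

lemma continuous_on_Min_component:
  fixes \<sigma> :: "'v::finite set"
  assumes "\<sigma> \<noteq> {}"
  shows "continuous_on S (\<lambda>x::real^'v. Min ((\<lambda>v. x $ v) ` \<sigma>))"
  using finite[of \<sigma>] assms
proof (induction \<sigma> rule: finite_ne_induct)
  case (insert v F)
  then have "continuous_on S (\<lambda>x. min (x $ v) (Min ((\<lambda>v. x $ v) ` F)))"
    by (intro continuous_on_min continuous_intros)
  with insert show ?case by simp
qed (auto intro: continuous_intros)

text \<open>Pushing out from the barycenter of the removed face by subtracting the least coordinate and
  rescaling.\<close>
lemma retract_punctured_geom_realization:
  fixes \<Delta> :: "'v::finite set set"
  assumes \<Delta>: "simplicial_complex \<Delta>"
    and \<sigma>: "\<sigma> \<in> \<Delta>" "\<sigma> \<noteq> {}" and max: "\<And>\<tau>. \<tau> \<in> \<Delta> \<Longrightarrow> \<sigma> \<subseteq> \<tau> \<Longrightarrow> \<tau> = \<sigma>"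
  shows "geom_realization (\<Delta> - {\<sigma>}) retract_of geom_realization \<Delta> - {barycenter \<sigma>}"
proof -
  have L: "simplicial_complex (\<Delta> - {\<sigma>})"
    using \<Delta> max unfolding simplicial_complex_def by blast
  define \<mu> where "\<mu> x = Min ((\<lambda>v. x $ v) ` \<sigma>)" for x :: "real^'v"
  let ?k = "real (card \<sigma>)"
  have k: "?k > 0" using \<sigma> by (simp add: card_gt_0_iff)
  \<comment> \<open>Subtracting \<open>\<mu> x\<close> on \<open>\<sigma>\<close> removes total mass
    \<open>?k * \<mu> x\<close>; the factor restores coordinate sum 1.\<close>
  define r where "r x = (1 / (1 - ?k * \<mu> x)) *\<^sub>R (x - \<mu> x *\<^sub>R (\<chi> v. if v \<in> \<sigma> then 1 else 0))" for x :: "real^'v"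
  have \<mu>_le: "\<mu> x \<le> x $ v" if "v \<in> \<sigma>" for x v
    using that by (auto simp: \<mu>_def)
  have \<mu>_at: "\<exists>v\<in>\<sigma>. \<mu> x = x $ v" for x
  proof -
    have "\<mu> x \<in> (\<lambda>v. x $ v) ` \<sigma>" unfolding \<mu>_def using \<sigma> by (intro Min_in) auto
    then show ?thesis by auto
  qed
  \<comment> \<open>Otherwise every coordinate of \<open>x\<close> dominates that of the barycenter,
    and equal coordinate sums force equality. Hence the denominator of \<open>r\<close> vanishes
    only at the puncture.\<close>
  have \<mu>_lt: "?k * \<mu> x < 1" if x: "x \<in> geom_realization \<Delta>" "x \<noteq> barycenter \<sigma>" for x
  proof (rule ccontr)
    assume "\<not> ?thesis"
    then have "1 / ?k \<le> \<mu> x" using k by (simp add: field_simps)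
    then have ge: "1 / ?k \<le> x $ v" if "v \<in> \<sigma>" for v using \<mu>_le[OF that, of x] by simp
    have nn: "0 \<le> x $ v" for v using x by (simp add: mem_geom_realization[OF \<Delta>])
    have "(\<Sum>v\<in>UNIV. x $ v - barycenter \<sigma> $ v) = 0"
      using x(1) barycenter_in_geom_realization[OF \<Delta> \<sigma>]
      by (simp add: sum_subtractf mem_geom_realization[OF \<Delta>])
    moreover have "0 \<le> x $ v - barycenter \<sigma> $ v" for v
      using ge nn by (simp add: barycenter_def)
    ultimately have "x $ v - barycenter \<sigma> $ v = 0" for v
      by (simp add: sum_nonneg_eq_0_iff)
    then have "x = barycenter \<sigma>" by (simp add: vec_eq_iff)
    with x show False by blast
  qed
  have r_nth: "r x $ v = (if v \<in> \<sigma> then x $ v - \<mu> x else x $ v) / (1 - ?k * \<mu> x)" for x v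
    by (simp add: r_def)
  show ?thesis
    unfolding retract_of_def retraction_def
  proof (intro exI[of _ r] conjI ballI)
    have "\<And>x. x \<in> geom_realization \<Delta> - {barycenter \<sigma>} \<Longrightarrow> 1 - ?k * \<mu> x \<noteq> 0"
      using \<mu>_lt by force
    then show "continuous_on (geom_realization \<Delta> - {barycenter \<sigma>}) r"
      unfolding r_def \<mu>_def by (intro continuous_intros continuous_on_Min_component \<sigma>) auto
    have "{v. barycenter \<sigma> $ v \<noteq> 0} = \<sigma>" using \<sigma> by (auto simp: barycenter_def)
    then show "geom_realization (\<Delta> - {\<sigma>}) \<subseteq> geom_realization \<Delta> - {barycenter \<sigma>}"
      by (auto simp: mem_geom_realization[OF L] mem_geom_realization[OF \<Delta>])
    show "r \<in> geom_realization \<Delta> - {barycenter \<sigma>} \<rightarrow> geom_realization (\<Delta> - {\<sigma>})"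
    proof
      fix x assume x: "x \<in> geom_realization \<Delta> - {barycenter \<sigma>}"
      then have pos: "1 - ?k * \<mu> x > 0" using \<mu>_lt[of x] by simp
      have xX: "\<And>v. 0 \<le> x $ v" "(\<Sum>v\<in>UNIV. x $ v) = 1" "{v. x $ v \<noteq> 0} \<in> \<Delta>"
        using x by (auto simp: mem_geom_realization[OF \<Delta>])
      obtain w where w: "w \<in> \<sigma>" "\<mu> x = x $ w" using \<mu>_at by blast
      have "0 \<le> \<mu> x" using w xX by simp
      have "r x $ v \<ge> 0" for v using pos xX \<mu>_le[of v x] by (simp add: r_nth)
      moreover have "(\<Sum>v\<in>UNIV. r x $ v) = 1"
      proof -
        have "(\<Sum>v\<in>UNIV. r x $ v) = (\<Sum>v\<in>UNIV. x $ v - (if v \<in> \<sigma> then \<mu> x else 0)) / (1 - ?k * \<mu> x)"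
          unfolding sum_divide_distrib by (rule sum.cong) (auto simp: r_nth)
        also have "(\<Sum>v\<in>UNIV. x $ v - (if v \<in> \<sigma> then \<mu> x else 0)) = 1 - ?k * \<mu> x"
          using xX by (simp add: sum_subtractf sum.If_cases)
        finally show ?thesis using pos by simp
      qed
      moreover have "{v. r x $ v \<noteq> 0} \<subseteq> {v. x $ v \<noteq> 0}"
        using \<mu>_le[of _ x] \<open>0 \<le> \<mu> x\<close> by (fastforce simp: r_nth split: if_splits)
      then have "{v. r x $ v \<noteq> 0} \<in> \<Delta>" using xX(3) \<Delta> unfolding simplicial_complex_def by blast
      \<comment> \<open>The vertex of \<open>\<sigma>\<close> where the minimum is attained drops
        out of the support.\<close>
      moreover have "{v. r x $ v \<noteq> 0} \<noteq> \<sigma>" using w by (auto simp: r_nth)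
      ultimately show "r x \<in> geom_realization (\<Delta> - {\<sigma>})" by (auto simp: mem_geom_realization[OF L])
    qed
    fix x assume x: "x \<in> geom_realization (\<Delta> - {\<sigma>})"
    \<comment> \<open>A positive minimum would put all of \<open>\<sigma>\<close> into the support,
      which by maximality would then be the removed face.\<close>
    have "\<mu> x = 0"
    proof (rule ccontr)
      assume "\<mu> x \<noteq> 0"
      obtain w where w: "w \<in> \<sigma>" "\<mu> x = x $ w" using \<mu>_at by blast
      with x \<open>\<mu> x \<noteq> 0\<close> have "\<mu> x > 0" by (simp add: mem_geom_realization[OF L] order_less_le)
      then have "\<sigma> \<subseteq> {v. x $ v \<noteq> 0}" using \<mu>_le[of _ x] by fastforce
      then show False using max[of "{v. x $ v \<noteq> 0}"] x by (auto simp: mem_geom_realization[OF L])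
    qed
    then show "r x = x" by (simp add: r_def)
  qed
qed

text \<open>A punctured sphere is homeomorphic to a hyperplane, hence contractible, and
  contractibility passes to retracts.\<close>

lemma acyclic_on_sphere_minus_facet:
  fixes \<Delta> :: "'v::{finite,linorder} set set"
  assumes \<Delta>: "simplicial_complex \<Delta>"
    and homeo: "geom_realization \<Delta> homeomorphic sphere (0::real^'m::finite) 1"
    and m: "CARD('m) \<ge> 2"
    and \<sigma>: "\<sigma> \<in> \<Delta>" and max: "\<And>\<tau>. \<tau> \<in> \<Delta> \<Longrightarrow> \<sigma> \<subseteq> \<tau> \<Longrightarrow> \<tau> = \<sigma>"
  shows "acyclic_on face_bd card (\<Delta> - {\<sigma>})"
proof (rule acyclic_on_contractible_complex)
  let ?X = "geom_realization \<Delta>" and ?S = "sphere (0::real^'m) 1"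
  show L: "simplicial_complex (\<Delta> - {\<sigma>})"
    using \<Delta> max unfolding simplicial_complex_def by blast
  have card: "card \<sigma> \<ge> 2" using card_maximal_face[OF \<Delta> homeo \<sigma> max] m by simp
  then have ne: "\<sigma> \<noteq> {}" by auto
  let ?b = "barycenter \<sigma>"
  have b: "?b \<in> ?X" by (rule barycenter_in_geom_realization[OF \<Delta> \<sigma> ne])
  obtain f g where fg: "homeomorphism ?X ?S f g"
    using homeo unfolding homeomorphic_def by blast
  have fb: "f ?b \<in> ?S" using fg b unfolding homeomorphism_def by blast
  have inj: "inj_on f ?X" using fg unfolding homeomorphism_def by (metis inj_on_inverseI)
  have "f ` (?X - {?b}) = ?S - {f ?b}"
    using inj b fg by (auto simp: homeomorphism_def inj_on_image_set_diff)
  then have "homeomorphism (?X - {?b}) (?S - {f ?b}) f g"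
    by (intro homeomorphism_of_subsets[OF fg]) auto
  then have "?X - {?b} homeomorphic ?S - {f ?b}" unfolding homeomorphic_def by blast
  also have "?S - {f ?b} homeomorphic {x. f ?b \<bullet> x = 0}"
    by (rule homeomorphic_punctured_sphere_hyperplane) (use fb in auto)
  finally have "?X - {?b} homeomorphic {x. f ?b \<bullet> x = 0}" .
  moreover have "contractible {x. f ?b \<bullet> x = 0}"
    by (intro convex_imp_contractible convex_hyperplane)
  ultimately have "contractible (?X - {?b})" by (simp add: homeomorphic_contractible_eq)
  then show "contractible (geom_realization (\<Delta> - {\<sigma>}))"
    using retract_of_contractible retract_punctured_geom_realization[OF \<Delta> \<sigma> ne max] by blast
  \<comment> \<open>The removed face has at least two vertices, so each of them survives as a face
    of its own.\<close>
  obtain v where v: "v \<in> \<sigma>" using ne by blast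
  then have "{v} \<in> \<Delta> - {\<sigma>}" using \<Delta> \<sigma> card unfolding simplicial_complex_def by auto
  then show "geom_realization (\<Delta> - {\<sigma>}) \<noteq> {}"
    using barycenter_in_geom_realization[OF L] by blast
qed

subsection \<open>The critical group\<close>

lemma lookup_frag_extend:
  fixes c :: "'a::finite \<Rightarrow>\<^sub>0 int"
  shows "Poly_Mapping.lookup (frag_extend f c) b = (\<Sum>a\<in>UNIV. Poly_Mapping.lookup c a * Poly_Mapping.lookup (f a) b)"
  unfolding frag_extend_def lookup_sum lookup_frag_cmul
  by (rule sum.mono_neutral_left) (auto simp: in_keys_iff)

lemma lookup_Abs_poly_mapping_finite:
  fixes c :: "'a::finite \<Rightarrow> int"
  shows "Poly_Mapping.lookup (Abs_poly_mapping c) = c"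
  by (simp add: Abs_poly_mapping_inverse)

lemma keys_Abs_poly_mapping_finite:
  fixes c :: "'a::finite \<Rightarrow> int"
  shows "Poly_Mapping.keys (Abs_poly_mapping c) = {a. c a \<noteq> 0}"
  by (auto simp: in_keys_iff lookup_Abs_poly_mapping_finite)

lemma bdry_coeff_nonzeroD:
  assumes "simplicial_complex \<Delta>" "\<sigma> \<in> faces \<Delta> i" "bdry_coeff \<sigma> \<tau> \<noteq> 0"
  shows "\<tau> \<in> lower_faces \<Delta> i"
  using assms by (auto simp: bdry_coeff_def faces_def lower_faces_def simplicial_complex_def split: if_splits)

text \<open>Truncating to \<open>lower_faces\<close> changes nothing, because downward closure makes
  every set with a nonzero coefficient a face of the complex.\<close>

lemma boundary_eq_frag_extend:
  fixes \<Delta> :: "'v::{finite,linorder} set set"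
  assumes "simplicial_complex \<Delta>" "c \<in> chains \<Delta> i"
  shows "boundary \<Delta> i c = Poly_Mapping.lookup (frag_extend face_bd (Abs_poly_mapping c))"
proof
  fix \<tau>
  have "Poly_Mapping.lookup (frag_extend face_bd (Abs_poly_mapping c)) \<tau> = (\<Sum>\<sigma>\<in>faces \<Delta> i. bdry_coeff \<sigma> \<tau> * c \<sigma>)"
    unfolding lookup_frag_extend lookup_face_bd lookup_Abs_poly_mapping_finite
    by (rule sum.mono_neutral_cong_right) (use assms(2) in \<open>auto simp: chains_def\<close>)
  moreover have "(\<Sum>\<sigma>\<in>faces \<Delta> i. bdry_coeff \<sigma> \<tau> * c \<sigma>) = 0" if "\<tau> \<notin> lower_faces \<Delta> i"
    using bdry_coeff_nonzeroD[OF assms(1)] that by (intro sum.neutral) auto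
  ultimately show "boundary \<Delta> i c \<tau> = Poly_Mapping.lookup (frag_extend face_bd (Abs_poly_mapping c)) \<tau>"
    by (simp add: boundary_def)
qed

lemma boundary_diff: "boundary \<Delta> i (\<lambda>\<sigma>. a \<sigma> - b \<sigma>) = (\<lambda>\<tau>. boundary \<Delta> i a \<tau> - boundary \<Delta> i b \<tau>)"
  by (auto simp: boundary_def right_diff_distrib sum_subtractf)

lemma boundary_add: "boundary \<Delta> i (\<lambda>\<sigma>. a \<sigma> + b \<sigma>) = (\<lambda>\<tau>. boundary \<Delta> i a \<tau> + boundary \<Delta> i b \<tau>)"
  by (auto simp: boundary_def distrib_left sum.distrib)

lemma boundary_scale: "boundary \<Delta> i (\<lambda>\<sigma>. k * a \<sigma>) = (\<lambda>\<tau>. k * boundary \<Delta> i a \<tau>)"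
  by (auto simp: boundary_def sum_distrib_left mult_ac intro!: sum.cong)

lemma lower_faces_eq_faces: "d \<ge> 1 \<Longrightarrow> lower_faces \<Delta> d = faces \<Delta> (d - 1)"
  by (auto simp: lower_faces_def faces_def)

lemma boundary_in_cycles:
  fixes \<Delta> :: "'v::{finite,linorder} set set"
  assumes \<Delta>: "simplicial_complex \<Delta>" and d: "d \<ge> 1" and c: "c \<in> chains \<Delta> d"
  shows "boundary \<Delta> d c \<in> cycles \<Delta> (d - 1)"
proof -
  have ch: "boundary \<Delta> d c \<in> chains \<Delta> (d - 1)"
    using lower_faces_eq_faces[OF d] by (auto simp: boundary_def chains_def)
  have "frag_extend face_bd (frag_extend face_bd (Abs_poly_mapping c)) = 0"
    unfolding frag_extend_frag_extend by (rule frag_extend_eq_0) (rule face_bd_face_bd)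
  then have "boundary \<Delta> (d - 1) (boundary \<Delta> d c) = (\<lambda>_. 0)"
    unfolding boundary_eq_frag_extend[OF \<Delta> ch] unfolding boundary_eq_frag_extend[OF \<Delta> c]
    by (simp add: poly_mapping.lookup_inverse fun_eq_iff)
  with ch show ?thesis by (simp add: cycles_def)
qed

text \<open>
  \<^term>\<open>S\<close> is the component in dimension \<^term>\<open>d - 1\<close> of a contracting homotopy of the augmented chain
  complex of \<^term>\<open>\<Delta> - {\<sigma>0}\<close>.
\<close>
definition facet_contraction :: "'v::{finite,linorder} set set \<Rightarrow> nat \<Rightarrow> 'v set \<Rightarrow> ('v set \<Rightarrow> 'v set \<Rightarrow> int) \<Rightarrow> bool" where
  "facet_contraction \<Delta> d \<sigma>0 S \<longleftrightarrow>
     (\<forall>\<tau>\<in>lower_faces \<Delta> d. S \<tau> \<in> chains \<Delta> d \<and> S \<tau> \<sigma>0 = 0) \<and>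
     (\<forall>\<sigma>\<in>faces \<Delta> d - {\<sigma>0}. \<forall>\<rho>. (\<Sum>\<tau>\<in>lower_faces \<Delta> d. bdry_coeff \<sigma> \<tau> * S \<tau> \<rho>) = (if \<rho> = \<sigma> then 1 else 0)) \<and>
     (\<forall>x\<in>cycles \<Delta> (d - 1). boundary \<Delta> d (\<lambda>\<rho>. \<Sum>\<tau>\<in>lower_faces \<Delta> d. x \<tau> * S \<tau> \<rho>) = x)"

text \<open>With the whole acyclic complex as constant carrier, the identity is homotopic to 0
  through some \<open>h\<close>. On facets \<open>h\<close> vanishes, leaving \<open>h\<close> after
  the boundary equal to the identity; on cycles one dimension lower, the boundary after
  \<open>h\<close> is the identity.\<close>

lemma facet_contraction_exists:
  fixes \<Delta> :: "'v::{finite,linorder} set set"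
  assumes \<Delta>: "simplicial_complex \<Delta>" and d: "d \<ge> 1"
    and \<sigma>0: "\<sigma>0 \<in> faces \<Delta> d" and dim: "\<And>\<sigma>. \<sigma> \<in> \<Delta> \<Longrightarrow> card \<sigma> \<le> d + 1"
    and acyclic: "acyclic_on face_bd card (\<Delta> - {\<sigma>0})"
  shows "\<exists>S. facet_contraction \<Delta> d \<sigma>0 S"
proof -
  let ?L = "\<Delta> - {\<sigma>0}"
  have card\<sigma>0: "card \<sigma>0 = d + 1" "\<sigma>0 \<in> \<Delta>" using \<sigma>0 by (auto simp: faces_def)
  have sub: "\<tau> \<in> ?L" if "\<sigma> \<in> \<Delta>" "\<tau> \<subset> \<sigma>" for \<sigma> \<tau>
  proof -
    have "card \<tau> < card \<sigma>" using that by (simp add: psubset_card_mono)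
    then show ?thesis using that dim[of \<sigma>] card\<sigma>0 \<Delta> unfolding simplicial_complex_def by auto
  qed
  have keysL: "Poly_Mapping.keys (face_bd \<sigma>) \<subseteq> {b \<in> ?L. Suc (card b) = card \<sigma>}" if "\<sigma> \<in> \<Delta>" for \<sigma>
  proof
    fix \<tau> assume "\<tau> \<in> Poly_Mapping.keys (face_bd \<sigma>)"
    then have "\<tau> \<subseteq> \<sigma>" "Suc (card \<tau>) = card \<sigma>" using keys_face_bd by blast+
    moreover from this have "\<tau> \<subset> \<sigma>" by auto
    ultimately show "\<tau> \<in> {b \<in> ?L. Suc (card b) = card \<sigma>}" using sub[OF that, of \<tau>] by auto
  qed
  \<comment> \<open>Start of the homotopy in rank 0: the empty face must be the boundary of a chain
    of vertices, that is, one with coefficient sum 1.\<close>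
  have "{} \<in> ?L" using sub[of \<sigma>0 "{}"] card\<sigma>0 by auto
  then obtain e where e: "Poly_Mapping.keys e \<subseteq> {b \<in> ?L. card b = 1}" "frag_extend face_bd e = frag_of {}"
    using acyclic_onD[OF acyclic, of "frag_of {}" 0] by auto
  obtain h where h:
    "\<And>\<sigma>. \<sigma> \<in> ?L \<Longrightarrow> Poly_Mapping.keys (h \<sigma>) \<subseteq> {\<tau> \<in> ?L. card \<tau> = card \<sigma> + 1}"
    "\<And>\<sigma>. \<sigma> \<in> ?L \<Longrightarrow> frag_extend face_bd (h \<sigma>) = frag_of \<sigma> + frag_cmul (- 1) (frag_extend h (face_bd \<sigma>))"
    by (rule acyclic_carrier[of ?L face_bd card "\<lambda>_. ?L" face_bd card "\<lambda>_. e" 1 frag_of "- 1"])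
      (use keysL acyclic e in \<open>auto simp: face_bd_face_bd simp flip: frag_expansion\<close>)
  have T: "\<tau> \<in> ?L" "card \<tau> = d" if "\<tau> \<in> lower_faces \<Delta> d" for \<tau>
    using that card\<sigma>0 by (auto simp: lower_faces_def)
  define S where "S \<tau> = Poly_Mapping.lookup (h \<tau>)" for \<tau>
  have 1: "S \<tau> \<in> chains \<Delta> d \<and> S \<tau> \<sigma>0 = 0" if "\<tau> \<in> lower_faces \<Delta> d" for \<tau>
    using h(1)[OF T(1)[OF that]] T(2)[OF that] unfolding S_def chains_def faces_def
    by (auto simp flip: not_in_keys_iff_lookup_eq_zero)
  have 2: "(\<Sum>\<tau>\<in>lower_faces \<Delta> d. bdry_coeff \<sigma> \<tau> * S \<tau> \<rho>) = (if \<rho> = \<sigma> then 1 else 0)"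
    if \<sigma>: "\<sigma> \<in> faces \<Delta> d - {\<sigma>0}" for \<sigma> \<rho>
  proof -
    have \<sigma>L: "\<sigma> \<in> ?L" "card \<sigma> = d + 1" using \<sigma> by (auto simp: faces_def)
    \<comment> \<open>\<open>h\<close> would take values on faces with \<open>d + 2\<close>
      vertices, and there are none.\<close>
    have "Poly_Mapping.keys (h \<sigma>) = {}" using h(1)[OF \<sigma>L(1)] \<sigma>L(2) dim by fastforce
    then have "h \<sigma> = 0" by simp
    then have "frag_of \<sigma> = frag_extend h (face_bd \<sigma>)" using h(2)[OF \<sigma>L(1)] by simp
    then have "Poly_Mapping.lookup (frag_of \<sigma>) \<rho> = (\<Sum>\<tau>\<in>UNIV. bdry_coeff \<sigma> \<tau> * S \<tau> \<rho>)"
      by (simp add: lookup_frag_extend lookup_face_bd S_def)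
    also have "\<dots> = (\<Sum>\<tau>\<in>lower_faces \<Delta> d. bdry_coeff \<sigma> \<tau> * S \<tau> \<rho>)"
      by (rule sum.mono_neutral_right) (use bdry_coeff_nonzeroD[OF \<Delta>, of \<sigma> d] \<sigma> in auto)
    finally show ?thesis by (simp add: lookup_single when_def)
  qed
  have 3: "boundary \<Delta> d (\<lambda>\<rho>. \<Sum>\<tau>\<in>lower_faces \<Delta> d. x \<tau> * S \<tau> \<rho>) = x" if x: "x \<in> cycles \<Delta> (d - 1)" for x
  proof -
    have xc: "x \<in> chains \<Delta> (d - 1)" "boundary \<Delta> (d - 1) x = (\<lambda>_. 0)" using x by (auto simp: cycles_def)
    let ?x = "Abs_poly_mapping x"
    have xT: "x \<tau> = 0" if "\<tau> \<notin> lower_faces \<Delta> d" for \<tau>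
      using xc(1) that lower_faces_eq_faces[OF d] by (auto simp: chains_def)
    have cyc: "frag_extend face_bd ?x = 0"
      using xc(2) unfolding boundary_eq_frag_extend[OF \<Delta> xc(1)] by (intro poly_mapping_eqI) simp
    have eq: "(\<lambda>\<rho>. \<Sum>\<tau>\<in>lower_faces \<Delta> d. x \<tau> * S \<tau> \<rho>) = Poly_Mapping.lookup (frag_extend h ?x)"
      unfolding lookup_frag_extend lookup_Abs_poly_mapping_finite S_def
      by (rule ext, rule sum.mono_neutral_left) (use xT in auto)
    have ch: "Poly_Mapping.lookup (frag_extend h ?x) \<in> chains \<Delta> d"
      unfolding eq[symmetric] using 1 by (auto simp: chains_def intro!: sum.neutral)
    have "frag_extend face_bd (frag_extend h ?x) = frag_extend (\<lambda>\<sigma>. frag_of \<sigma> - frag_extend h (face_bd \<sigma>)) ?x"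
      unfolding frag_extend_frag_extend
    proof (rule frag_extend_eq)
      fix \<tau> assume "\<tau> \<in> Poly_Mapping.keys ?x"
      then have "\<tau> \<in> lower_faces \<Delta> d" using xT by (auto simp: keys_Abs_poly_mapping_finite)
      then show "frag_extend face_bd (h \<tau>) = frag_of \<tau> - frag_extend h (face_bd \<tau>)" using h(2) T by simp
    qed
    also have "\<dots> = ?x"
      using cyc by (simp add: frag_extend_diff_fun flip: frag_extend_frag_extend frag_expansion)
    finally show ?thesis
      unfolding eq boundary_eq_frag_extend[OF \<Delta> ch]
      by (simp add: poly_mapping.lookup_inverse lookup_Abs_poly_mapping_finite)
  qed
  show ?thesis unfolding facet_contraction_def using 1 2 3 by blast
qed

text \<open>All that is retained of the sphere. A contraction is available for each choice of
  removed facet, and varying this facet later shows that every coefficient of the fundamental cycle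
  is a unit.\<close>

locale facet_contractible_complex =
  fixes \<Delta> :: "'v::{finite,linorder} set set" and d :: nat
  assumes complex: "simplicial_complex \<Delta>" and d: "d \<ge> 1"
    and facets_nonempty: "faces \<Delta> d \<noteq> {}"
    and contraction: "\<And>\<sigma>. \<sigma> \<in> faces \<Delta> d \<Longrightarrow> \<exists>S. facet_contraction \<Delta> d \<sigma> S"
begin

section \<open>The fundamental cycle and the pairing with it\<close>

abbreviation pairing :: "('v set \<Rightarrow> int) \<Rightarrow> ('v set \<Rightarrow> int) \<Rightarrow> int" where
  "pairing a b \<equiv> (\<Sum>\<sigma>\<in>faces \<Delta> d. a \<sigma> * b \<sigma>)"

lemma pairing_coboundary: "pairing a (coboundary \<Delta> d u) = (\<Sum>\<tau>\<in>lower_faces \<Delta> d. boundary \<Delta> d a \<tau> * u \<tau>)"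
proof -
  have "pairing a (coboundary \<Delta> d u) = (\<Sum>\<sigma>\<in>faces \<Delta> d. \<Sum>\<tau>\<in>lower_faces \<Delta> d. a \<sigma> * bdry_coeff \<sigma> \<tau> * u \<tau>)"
    by (simp add: coboundary_def sum_distrib_left mult_ac)
  also have "\<dots> = (\<Sum>\<tau>\<in>lower_faces \<Delta> d. \<Sum>\<sigma>\<in>faces \<Delta> d. a \<sigma> * bdry_coeff \<sigma> \<tau> * u \<tau>)"
    by (rule sum.swap)
  finally show ?thesis by (simp add: boundary_def sum_distrib_left sum_distrib_right mult_ac)
qed

text \<open>The contraction is a left inverse of the boundary on chains that avoid
  \<open>\<sigma>0\<close>.\<close>

lemma chain_eq_contraction_boundary:
  assumes S: "facet_contraction \<Delta> d \<sigma>0 S" and c: "c \<in> chains \<Delta> d" "c \<sigma>0 = 0"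
  shows "c \<rho> = (\<Sum>\<tau>\<in>lower_faces \<Delta> d. boundary \<Delta> d c \<tau> * S \<tau> \<rho>)"
proof -
  have "(\<Sum>\<tau>\<in>lower_faces \<Delta> d. boundary \<Delta> d c \<tau> * S \<tau> \<rho>) =
      (\<Sum>\<tau>\<in>lower_faces \<Delta> d. \<Sum>\<sigma>\<in>faces \<Delta> d. c \<sigma> * (bdry_coeff \<sigma> \<tau> * S \<tau> \<rho>))"
    by (simp add: boundary_def sum_distrib_left sum_distrib_right mult_ac)
  also have "\<dots> = (\<Sum>\<sigma>\<in>faces \<Delta> d. c \<sigma> * (\<Sum>\<tau>\<in>lower_faces \<Delta> d. bdry_coeff \<sigma> \<tau> * S \<tau> \<rho>))"
    by (subst sum.swap) (simp add: sum_distrib_left)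
  also have "\<dots> = (\<Sum>\<sigma>\<in>faces \<Delta> d. if \<sigma> = \<rho> then c \<sigma> else 0)"
  proof (rule sum.cong)
    fix \<sigma> assume "\<sigma> \<in> faces \<Delta> d"
    then show "c \<sigma> * (\<Sum>\<tau>\<in>lower_faces \<Delta> d. bdry_coeff \<sigma> \<tau> * S \<tau> \<rho>) = (if \<sigma> = \<rho> then c \<sigma> else 0)"
      using S c(2) unfolding facet_contraction_def by (cases "\<sigma> = \<sigma>0") auto
  qed simp
  also have "\<dots> = c \<rho>" using c(1) by (simp add: chains_def)
  finally show ?thesis by simp
qed

lemma cycle_eq_0:
  assumes "\<sigma>0 \<in> faces \<Delta> d" "c \<in> chains \<Delta> d" "boundary \<Delta> d c = (\<lambda>_. 0)" "c \<sigma>0 = 0"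
  shows "c = (\<lambda>_. 0)"
proof -
  obtain S where "facet_contraction \<Delta> d \<sigma>0 S" using contraction[OF assms(1)] by blast
  from chain_eq_contraction_boundary[OF this assms(2,4)] assms(3) show ?thesis by auto
qed

lemma cycles_bound:
  assumes "\<sigma>0 \<in> faces \<Delta> d" "x \<in> cycles \<Delta> (d - 1)"
  obtains e where "e \<in> chains \<Delta> d" "e \<sigma>0 = 0" "boundary \<Delta> d e = x"
proof -
  obtain S where S: "facet_contraction \<Delta> d \<sigma>0 S" using contraction[OF assms(1)] by blast
  show thesis
    by (rule that[of "\<lambda>\<rho>. \<Sum>\<tau>\<in>lower_faces \<Delta> d. x \<tau> * S \<tau> \<rho>"])
      (use S assms(2) in \<open>auto simp: facet_contraction_def chains_def intro!: sum.neutral\<close>)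
qed

text \<open>The boundary of the facet \<open>\<sigma>0\<close> also bounds a chain \<open>e\<close>
  avoiding \<open>\<sigma>0\<close>; the facet minus \<open>e\<close> is the required cycle.\<close>

lemma fundamental_cycle_at:
  assumes "\<sigma>0 \<in> faces \<Delta> d"
  obtains z where "z \<in> chains \<Delta> d" "boundary \<Delta> d z = (\<lambda>_. 0)" "z \<sigma>0 = 1"
proof -
  let ?s = "\<lambda>\<sigma>. if \<sigma> = \<sigma>0 then 1 else (0::int)"
  have s: "?s \<in> chains \<Delta> d" using assms by (auto simp: chains_def)
  obtain e where "e \<in> chains \<Delta> d" "e \<sigma>0 = 0" "boundary \<Delta> d e = boundary \<Delta> d ?s"
    using cycles_bound[OF assms boundary_in_cycles[OF complex d s]] by blast
  then show thesis
    using that[of "\<lambda>\<sigma>. ?s \<sigma> - e \<sigma>"] s by (auto simp: boundary_diff chains_def)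
qed

text \<open>Subtracting \<open>y \<sigma>0\<close> times \<open>z\<close> from a cycle
  \<open>y\<close> leaves a cycle vanishing at \<open>\<sigma>0\<close>, hence 0. Comparing with a
  cycle that is 1 at another facet \<open>\<sigma>\<close> shows that \<open>z \<sigma>\<close>
  divides 1.\<close>

lemma fundamental_cycle:
  obtains z where "z \<in> chains \<Delta> d" "boundary \<Delta> d z = (\<lambda>_. 0)"
    "\<And>\<sigma>. \<sigma> \<in> faces \<Delta> d \<Longrightarrow> z \<sigma> * z \<sigma> = 1"
    "\<And>y. y \<in> chains \<Delta> d \<Longrightarrow> boundary \<Delta> d y = (\<lambda>_. 0) \<Longrightarrow> \<exists>k. y = (\<lambda>\<sigma>. k * z \<sigma>)"
proof -
  obtain \<sigma>0 where \<sigma>0: "\<sigma>0 \<in> faces \<Delta> d" using facets_nonempty by blast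
  obtain z where z: "z \<in> chains \<Delta> d" "boundary \<Delta> d z = (\<lambda>_. 0)" "z \<sigma>0 = 1"
    using fundamental_cycle_at[OF \<sigma>0] by blast
  have mult: "y = (\<lambda>\<sigma>. y \<sigma>0 * z \<sigma>)" if y: "y \<in> chains \<Delta> d" "boundary \<Delta> d y = (\<lambda>_. 0)" for y
  proof -
    have eq: "(\<lambda>\<sigma>. y \<sigma> - y \<sigma>0 * z \<sigma>) = (\<lambda>_. 0)"
      by (rule cycle_eq_0[OF \<sigma>0]) (use y z in \<open>auto simp: chains_def boundary_diff boundary_scale\<close>)
    show ?thesis
    proof
      fix \<sigma>
      from fun_cong[OF eq, of \<sigma>] show "y \<sigma> = y \<sigma>0 * z \<sigma>" by simp
    qed
  qed
  have "z \<sigma> * z \<sigma> = 1" if \<sigma>: "\<sigma> \<in> faces \<Delta> d" for \<sigma>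
  proof -
    obtain y where y: "y \<in> chains \<Delta> d" "boundary \<Delta> d y = (\<lambda>_. 0)" "y \<sigma> = 1"
      using fundamental_cycle_at[OF \<sigma>] by blast
    have "y \<sigma>0 * z \<sigma> = 1" using fun_cong[OF mult[OF y(1,2)], of \<sigma>] y(3) by simp
    then have "z \<sigma> = 1 \<or> z \<sigma> = - 1" by (auto simp: zmult_eq_1_iff)
    then show ?thesis by auto
  qed
  then show thesis using that[OF z(1,2)] mult by metis
qed

text \<open>The transpose of the contraction, applied to \<open>c\<close>, gives a \<open>u\<close>
  whose coboundary is correct off \<open>\<sigma>0\<close>. The defect is then supported at
  \<open>\<sigma>0\<close> and orthogonal to \<open>z\<close>, so it is 0 because
  \<open>z \<sigma>0\<close> is a unit.\<close>

lemma orthogonal_fundamental_cycle_coboundary: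
  assumes z: "z \<in> chains \<Delta> d" "boundary \<Delta> d z = (\<lambda>_. 0)" "\<And>\<sigma>. \<sigma> \<in> faces \<Delta> d \<Longrightarrow> z \<sigma> * z \<sigma> = 1"
    and c: "c \<in> chains \<Delta> d" "pairing z c = 0"
  obtains u where "u \<in> chains \<Delta> (d - 1)" "coboundary \<Delta> d u = c"
proof -
  obtain \<sigma>0 where \<sigma>0: "\<sigma>0 \<in> faces \<Delta> d" using facets_nonempty by blast
  obtain S where S: "facet_contraction \<Delta> d \<sigma>0 S" using contraction[OF \<sigma>0] by blast
  define u where "u \<tau> = (if \<tau> \<in> lower_faces \<Delta> d then \<Sum>\<rho>\<in>faces \<Delta> d. c \<rho> * S \<tau> \<rho> else 0)" for \<tau>
  have uc: "u \<in> chains \<Delta> (d - 1)" using lower_faces_eq_faces[OF d] by (auto simp: u_def chains_def)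
  have off: "coboundary \<Delta> d u \<sigma> = c \<sigma>" if \<sigma>: "\<sigma> \<in> faces \<Delta> d - {\<sigma>0}" for \<sigma>
  proof -
    have "coboundary \<Delta> d u \<sigma> = (\<Sum>\<tau>\<in>lower_faces \<Delta> d. \<Sum>\<rho>\<in>faces \<Delta> d. c \<rho> * (bdry_coeff \<sigma> \<tau> * S \<tau> \<rho>))"
      using \<sigma> by (simp add: coboundary_def u_def sum_distrib_left mult_ac)
    also have "\<dots> = (\<Sum>\<rho>\<in>faces \<Delta> d. c \<rho> * (\<Sum>\<tau>\<in>lower_faces \<Delta> d. bdry_coeff \<sigma> \<tau> * S \<tau> \<rho>))"
      by (subst sum.swap) (simp add: sum_distrib_left)
    also have "\<dots> = (\<Sum>\<rho>\<in>faces \<Delta> d. if \<rho> = \<sigma> then c \<rho> else 0)"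
      using S \<sigma> unfolding facet_contraction_def by (intro sum.cong) auto
    also have "\<dots> = c \<sigma>" using \<sigma> by simp
    finally show ?thesis .
  qed
  define D where "D \<sigma> = coboundary \<Delta> d u \<sigma> - c \<sigma>" for \<sigma>
  have "pairing z D = 0"
    using pairing_coboundary[of z u] z(2) c(2) by (simp add: D_def right_diff_distrib sum_subtractf)
  moreover have "pairing z D = (\<Sum>\<sigma>\<in>faces \<Delta> d. if \<sigma> = \<sigma>0 then z \<sigma>0 * D \<sigma>0 else 0)"
    by (rule sum.cong) (auto simp: D_def off)
  ultimately have "z \<sigma>0 * D \<sigma>0 = 0" using \<sigma>0 by simp
  then have "D \<sigma>0 = 0" using z(3)[OF \<sigma>0] by auto
  have "coboundary \<Delta> d u = c"
  proof
    fix \<sigma>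
    consider "\<sigma> = \<sigma>0" | "\<sigma> \<in> faces \<Delta> d - {\<sigma>0}" | "\<sigma> \<notin> faces \<Delta> d" by blast
    then show "coboundary \<Delta> d u \<sigma> = c \<sigma>"
    proof cases
      case 1
      with \<open>D \<sigma>0 = 0\<close> show ?thesis by (simp add: D_def)
    next
      case 3
      with c(1) show ?thesis by (simp add: coboundary_def chains_def)
    qed (rule off)
  qed
  with uc show thesis using that by blast
qed

lemma critical_group_iso: "critical_group \<Delta> (d - 1) \<cong> integer_mod_group (card (faces \<Delta> d))"
proof -
  let ?n = "card (faces \<Delta> d)"
  let ?G = "(chain_group \<Delta> (d - 1))\<lparr>carrier := cycles \<Delta> (d - 1)\<rparr>"
  let ?H = "integer_mod_group ?n"
  have n: "?n > 0" using facets_nonempty by (simp add: card_gt_0_iff)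
  obtain z where z: "z \<in> chains \<Delta> d" "boundary \<Delta> d z = (\<lambda>_. 0)"
    "\<And>\<sigma>. \<sigma> \<in> faces \<Delta> d \<Longrightarrow> z \<sigma> * z \<sigma> = 1"
    "\<And>y. y \<in> chains \<Delta> d \<Longrightarrow> boundary \<Delta> d y = (\<lambda>_. 0) \<Longrightarrow> \<exists>k. y = (\<lambda>\<sigma>. k * z \<sigma>)"
    using fundamental_cycle by blast
  have zz: "pairing z z = int ?n" using z(3) by simp
  obtain \<sigma>0 where \<sigma>0: "\<sigma>0 \<in> faces \<Delta> d" using facets_nonempty by blast
  \<comment> \<open>The filling is an arbitrary choice; two fillings differ by a multiple of
    \<open>z\<close>, which changes the pairing by a multiple of \<open>pairing z z\<close>, the
    number of facets.\<close>
  define \<theta> where "\<theta> x = pairing z (SOME e. e \<in> chains \<Delta> d \<and> boundary \<Delta> d e = x) mod int ?n" for x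
  have same: "pairing z a mod int ?n = pairing z b mod int ?n"
    if "a \<in> chains \<Delta> d" "b \<in> chains \<Delta> d" "boundary \<Delta> d a = boundary \<Delta> d b" for a b
  proof -
    have "\<exists>k. (\<lambda>\<sigma>. a \<sigma> - b \<sigma>) = (\<lambda>\<sigma>. k * z \<sigma>)"
      by (rule z(4)) (use that in \<open>auto simp: chains_def boundary_diff\<close>)
    then obtain k where "\<And>\<sigma>. a \<sigma> = b \<sigma> + k * z \<sigma>" by (auto simp: fun_eq_iff algebra_simps)
    then have "pairing z a = pairing z b + k * pairing z z"
      by (simp add: distrib_left sum.distrib sum_distrib_left mult_ac)
    then show ?thesis by (simp add: zz)
  qed
  have \<theta>: "\<theta> (boundary \<Delta> d e) = pairing z e mod int ?n" if e: "e \<in> chains \<Delta> d" for e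
  proof -
    have "\<exists>e'. e' \<in> chains \<Delta> d \<and> boundary \<Delta> d e' = boundary \<Delta> d e" using e by blast
    from someI_ex[OF this] show ?thesis unfolding \<theta>_def using e by (intro same) auto
  qed
  have bound: "\<exists>e\<in>chains \<Delta> d. x = boundary \<Delta> d e" if "x \<in> cycles \<Delta> (d - 1)" for x
    using cycles_bound[OF \<sigma>0 that] by metis
  have cyc_add: "(\<lambda>\<sigma>. x \<sigma> + y \<sigma>) \<in> cycles \<Delta> (d - 1)" if "x \<in> cycles \<Delta> (d - 1)" "y \<in> cycles \<Delta> (d - 1)" for x y
    using that by (auto simp: cycles_def chains_def boundary_add)
  have cyc_uminus: "(\<lambda>\<sigma>. - x \<sigma>) \<in> cycles \<Delta> (d - 1)" if "x \<in> cycles \<Delta> (d - 1)" for x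
    using that boundary_scale[of \<Delta> "d - 1" "-1" x] by (auto simp: cycles_def chains_def)
  have cyc_0: "(\<lambda>\<sigma>. 0) \<in> cycles \<Delta> (d - 1)"
    by (auto simp: cycles_def chains_def boundary_def)
  have G: "group ?G"
  proof (rule groupI)
    show "\<exists>y\<in>carrier ?G. y \<otimes>\<^bsub>?G\<^esub> x = \<one>\<^bsub>?G\<^esub>" if "x \<in> carrier ?G" for x
      using that cyc_uminus by (intro bexI[of _ "\<lambda>\<sigma>. - x \<sigma>"]) (auto simp: chain_group_def)
  qed (use cyc_add cyc_0 in \<open>auto simp: chain_group_def add.assoc\<close>)
  have hom: "\<theta> \<in> hom ?G ?H"
  proof (rule homI)
    show "\<theta> x \<in> carrier ?H" for x
      using n by (auto simp: \<theta>_def carrier_integer_mod_group)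
    fix x y assume "x \<in> carrier ?G" "y \<in> carrier ?G"
    then obtain a b where ab: "a \<in> chains \<Delta> d" "x = boundary \<Delta> d a" "b \<in> chains \<Delta> d" "y = boundary \<Delta> d b"
      using bound[of x] bound[of y] by auto
    then have "x \<otimes>\<^bsub>?G\<^esub> y = boundary \<Delta> d (\<lambda>\<sigma>. a \<sigma> + b \<sigma>)" "(\<lambda>\<sigma>. a \<sigma> + b \<sigma>) \<in> chains \<Delta> d"
      by (auto simp: chain_group_def boundary_add chains_def)
    then have "\<theta> (x \<otimes>\<^bsub>?G\<^esub> y) = (pairing z a + pairing z b) mod int ?n"
      by (simp add: \<theta> distrib_left sum.distrib)
    then show "\<theta> (x \<otimes>\<^bsub>?G\<^esub> y) = \<theta> x \<otimes>\<^bsub>?H\<^esub> \<theta> y"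
      using ab by (simp add: \<theta> mod_add_eq)
  qed
  interpret gh: group_hom ?G ?H \<theta>
    using G hom by (simp add: group_hom_def group_hom_axioms_def)
  have surj: "\<theta> ` carrier ?G = carrier ?H"
  proof
    show "\<theta> ` carrier ?G \<subseteq> carrier ?H" using hom by (auto simp: hom_def)
    show "carrier ?H \<subseteq> \<theta> ` carrier ?G"
    proof
      fix k assume k: "k \<in> carrier ?H"
      \<comment> \<open>The factor \<open>z \<sigma>0\<close> is its own inverse, so this chain
        pairs with \<open>z\<close> to exactly \<open>k\<close>.\<close>
      let ?e = "\<lambda>\<sigma>. if \<sigma> = \<sigma>0 then k * z \<sigma>0 else 0"
      have e: "?e \<in> chains \<Delta> d" using \<sigma>0 by (auto simp: chains_def)
      have "pairing z ?e = (\<Sum>\<sigma>\<in>faces \<Delta> d. if \<sigma> = \<sigma>0 then k else 0)"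
        by (rule sum.cong) (use z(3)[OF \<sigma>0] in \<open>auto simp: mult.left_commute\<close>)
      then have "pairing z ?e = k" using \<sigma>0 by simp
      then have "\<theta> (boundary \<Delta> d ?e) = k"
        using \<theta>[OF e] k facets_nonempty by (simp add: carrier_integer_mod_group)
      then show "k \<in> \<theta> ` carrier ?G"
        using boundary_in_cycles[OF complex d e] by (metis (no_types, lifting) image_eqI partial_object.select_convs(1) partial_object.surjective partial_object.update_convs(1))
    qed
  qed
  have lap: "laplacian_image \<Delta> (d - 1) = (\<lambda>c. boundary \<Delta> d (coboundary \<Delta> d c)) ` chains \<Delta> (d - 1)"
    using d by (simp add: laplacian_image_def)
  have cob: "coboundary \<Delta> d u \<in> chains \<Delta> d" for u by (auto simp: coboundary_def chains_def)
  have "kernel ?G ?H \<theta> = laplacian_image \<Delta> (d - 1)"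
  proof (intro equalityI subsetI)
    fix x assume "x \<in> kernel ?G ?H \<theta>"
    then have "x \<in> cycles \<Delta> (d - 1)" and "\<theta> x = 0" by (auto simp: kernel_def)
    then obtain e where e: "e \<in> chains \<Delta> d" "x = boundary \<Delta> d e" using bound by blast
    then obtain k where k: "pairing z e = int ?n * k" using \<open>\<theta> x = 0\<close> \<theta> by auto
    \<comment> \<open>Removing \<open>k\<close> copies of the cycle \<open>z\<close> keeps the
      boundary and lowers the pairing from \<open>int ?n * k\<close> to 0, so the new filling is a
      coboundary.\<close>
    let ?c = "\<lambda>\<sigma>. e \<sigma> - k * z \<sigma>"
    have c: "?c \<in> chains \<Delta> d" using e z by (auto simp: chains_def)
    have "pairing z ?c = pairing z e - k * pairing z z"
      by (simp add: right_diff_distrib sum_subtractf sum_distrib_left mult_ac)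
    then have "pairing z ?c = 0" using k zz by simp
    then obtain u where u: "u \<in> chains \<Delta> (d - 1)" "coboundary \<Delta> d u = ?c"
      using orthogonal_fundamental_cycle_coboundary[OF z(1,2,3) c] by blast
    have "boundary \<Delta> d ?c = x" using e z(2) by (simp add: boundary_diff boundary_scale)
    then show "x \<in> laplacian_image \<Delta> (d - 1)" unfolding lap using u by (metis (no_types, lifting) image_eqI)
  next
    fix x assume "x \<in> laplacian_image \<Delta> (d - 1)"
    then obtain u where u: "x = boundary \<Delta> d (coboundary \<Delta> d u)" unfolding lap by blast
    have "\<theta> x = 0" unfolding u \<theta>[OF cob] pairing_coboundary using z(2) by simp
    moreover have "x \<in> cycles \<Delta> (d - 1)" unfolding u by (rule boundary_in_cycles[OF complex d cob])
    ultimately show "x \<in> kernel ?G ?H \<theta>" by (simp add: kernel_def)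
  qed
  then show ?thesis
    using gh.FactGroup_iso[OF surj] by (simp add: critical_group_def)
qed

end

theorem mainTheorem9:
  fixes \<Sigma> :: "('v::{finite,linorder}) set set" and d n :: nat
  assumes "d \<ge> 1"
    and "simplicial_complex \<Sigma>"
    and "CARD('m::finite) = d + 1"
    and "geom_realization \<Sigma> homeomorphic sphere (0::real^'m) 1"
    and "n = card (faces \<Sigma> d)"
  shows "critical_group \<Sigma> (d - 1) \<cong> integer_mod_group n"
proof -
  \<comment> \<open>Purity: every face lies in a maximal one, and maximal faces have
    \<open>d + 1\<close> vertices. This bounds the dimension, yields a facet, and makes every facet
    maximal.\<close>
  have maximal: "\<exists>\<tau>\<in>faces \<Sigma> d. \<sigma> \<subseteq> \<tau>" if "\<sigma> \<in> \<Sigma>" for \<sigma>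
  proof -
    obtain \<tau> where \<tau>: "\<tau> \<in> \<Sigma>" "\<sigma> \<subseteq> \<tau>" "\<forall>\<rho>\<in>\<Sigma>. \<tau> \<subseteq> \<rho> \<longrightarrow> \<tau> = \<rho>"
      using finite_has_maximal2[OF finite \<open>\<sigma> \<in> \<Sigma>\<close>] by blast
    then have "card \<tau> = CARD('m)"
      by (intro card_maximal_face[OF assms(2,4)]) auto
    with \<tau> assms(3) show ?thesis by (auto simp: faces_def)
  qed
  have dim: "card \<sigma> \<le> d + 1" if "\<sigma> \<in> \<Sigma>" for \<sigma>
    using maximal[OF that] by (auto simp: faces_def) (metis card_mono finite)
  have "geom_realization \<Sigma> \<noteq> {}"
    using assms(4) homeomorphic_empty(2) by fastforce
  then have "\<Sigma> \<noteq> {}" by (auto simp: geom_realization_def)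
  then have nonempty: "faces \<Sigma> d \<noteq> {}" using maximal by blast
  have contr: "\<exists>S. facet_contraction \<Sigma> d \<sigma> S" if \<sigma>: "\<sigma> \<in> faces \<Sigma> d" for \<sigma>
  proof (rule facet_contraction_exists[OF assms(2,1) \<sigma> dim])
    show "acyclic_on face_bd card (\<Sigma> - {\<sigma>})"
    proof (rule acyclic_on_sphere_minus_facet[OF assms(2,4)])
      show "\<sigma> \<in> \<Sigma>" using \<sigma> by (simp add: faces_def)
      show "\<tau> = \<sigma>" if "\<tau> \<in> \<Sigma>" "\<sigma> \<subseteq> \<tau>" for \<tau>
        using dim[OF that(1)] that(2) \<sigma> by (metis (mono_tags, lifting) card_seteq faces_def finite mem_Collect_eq)
    qed (use assms in auto)
  qed
  interpret facet_contractible_complex \<Sigma> d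
    by unfold_locales (use assms nonempty contr in auto)
  show ?thesis unfolding assms(5) by (rule critical_group_iso)
qed

end
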